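(* For the free-infinitely divisible Voiculescu transform $$V_{\tilde T}(iw)=-F_{\tilde T}(iw)=F_{\tilde S}(iw)-F_{\tilde C}(iw)=iw\Big[\log\Big(\frac{w}{2}\Big)-\beta\Big(\frac{w}{2}\Big)-\psi\Big(\frac{w}{2}\Big)\Big],\qquad w>0,$$ the characteristics are given by $a_{\tilde T}=b_{\tilde T}=0$, and the measure $\rho_{\tilde T}$ is such that $\rho_{\tilde T}(\mathbb{R})=\frac{\pi}{2}-\gamma-\log2$ and, for all $s\in\mathbb{R}$, $$\mathfrak{F}[\rho_{\tilde T}\,;\,s]=\frac{\pi}{2}e^{-|s|}+2\sinh(|s|)\arctan(e^{-|s|})+\cosh(s)\,\log\frac{1-e^{-|s|}}{1+e^{-|s|}}-\frac{e^{-s}\,\mathrm{Ei}(s)+e^{s}\,\mathrm{Ei}(-s)}{2}=\int_0^\infty\cos(sx)\,\frac{2x}{(1+x^2)\left(e^{\frac{\pi}{2}x}+1\right)}\,dx,$$ where the middle expression is understood by continuity at $s=0$.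
   Context: $\beta(z)=\int_0^\infty e^{-zx}\frac{dx}{1+e^{-x}}$ for $\Re(z)>0$; $\psi=\Gamma'/\Gamma$ is the digamma function; $\gamma=-\psi(1)$ is the Euler-Mascheroni constant. $\mathrm{Ei}$ is the exponential integral function, $\mathrm{Ei}(x)=-\int_{-x}^\infty\frac{e^{-t}}{t}dt$ for $x<0$, and the corresponding Cauchy principal value for $x>0$; equivalently, $\mathrm{Ei}(x)=\gamma+\log|x|+\sum_{k\ge1}\frac{x^k}{k\cdot k!}$ for $x\ne0$. The functions $F_{\tilde C}$ and $F_{\tilde S}$ are defined by $-F_{\tilde C}(iw)=i\big[1-w\beta(\frac{w}{2})\big]$ and $-F_{\tilde S}(iw)=i\big[w\psi(\frac{w}{2})-w\log(\frac{w}{2})+1\big]$, $w>0$. The characteristics $(a_X,b_X,\rho_X)$ of $F_X$ are the unique $a_X\in\mathbb{R}$, $b_X\ge0$ and finite non-negative Borel measure $\rho_X$ on $\mathbb{R}$ such that $$F_X(iw)=a_X+i\,b_X\,w+\int_{\mathbb{R}}\frac{iwx-1}{iw+x}\,\rho_X(dx),\qquad w>0.$$ Here $V_X=-F_X$, and $\mathfrak{F}[\rho\,;\,s]=\int_{\mathbb{R}}e^{isx}\rho(dx)$. The label $\tilde T$ refers to the free-probability analog of the random variable $T$ with characteristic function $\tanh(s)/s$; the function $F_{\tilde T}$ is the one explicitly given in the claim. *)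

theory Defs
  imports "HOL-Probability.Probability"
begin

definition beta_fun :: "complex \<Rightarrow> complex" where
  "beta_fun z = (CLINT x:{0..}|lborel. exp (- z * of_real x) / (1 + exp (- of_real x)))"

text \<open>
  For \<open>x > 0\<close> the integrand has a pole at \<open>t = 0\<close>, and the integral over \<open>{-x..}\<close> is the
  Cauchy principal value. The value at \<open>0\<close> has no meaning.
\<close>

definition Ei :: "real \<Rightarrow> real" where
  "Ei x = (if x < 0 then - (LINT t:{-x..}|lborel. exp (-t) / t)
           else - Lim (at_right 0) (\<lambda>e. LINT t:{-x..-e} \<union> {e..}|lborel. exp (-t) / t))"

text \<open>
  The functions below are prescribed only at points \<open>z = \<i> * w\<close> with \<open>w > 0\<close>. They are written
  with \<open>z / \<i>\<close> in place of \<open>w\<close>, which is their analytic extension to the upper half-plane.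
  The lemmas \<open>F_C_axis\<close>, \<open>F_S_axis\<close> and \<open>F_T_axis\<close> give back the prescribed values.
\<close>

definition F_C :: "complex \<Rightarrow> complex" where
  "F_C z = - (\<i> * (1 - (z / \<i>) * beta_fun (z / \<i> / 2)))"

definition F_S :: "complex \<Rightarrow> complex" where
  "F_S z = - (\<i> * ((z / \<i>) * Digamma (z / \<i> / 2) - (z / \<i>) * Ln (z / \<i> / 2) + 1))"

definition F_T :: "complex \<Rightarrow> complex" where
  "F_T z = - (z * (Ln (z / \<i> / 2) - beta_fun (z / \<i> / 2) - Digamma (z / \<i> / 2)))"

definition V_T :: "complex \<Rightarrow> complex" where
  "V_T z = - F_T z"

lemma F_C_axis:
  fixes w :: real
  assumes "w > 0"
  shows "- F_C (\<i> * of_real w) = \<i> * (1 - of_real w * beta_fun (of_real (w / 2)))"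
  by (simp add: F_C_def)

lemma F_S_axis:
  fixes w :: real
  assumes "w > 0"
  shows "- F_S (\<i> * of_real w) =
    \<i> * (of_real w * Digamma (of_real (w / 2)) - of_real w * of_real (ln (w / 2)) + 1)"
  using assms Ln_of_real[of "w / 2"] by (simp add: F_S_def)

lemma F_T_axis:
  fixes w :: real
  assumes "w > 0"
  shows "- F_T (\<i> * of_real w) =
    \<i> * of_real w * (of_real (ln (w / 2)) - beta_fun (of_real (w / 2)) - Digamma (of_real (w / 2)))"
  using assms Ln_of_real[of "w / 2"] by (simp add: F_T_def)

definition has_representation ::
    "(complex \<Rightarrow> complex) \<Rightarrow> real \<Rightarrow> real \<Rightarrow> real measure \<Rightarrow> bool" where
  "has_representation F a b \<rho> \<longleftrightarrow>
     b \<ge> 0 \<and> finite_borel_measure \<rho> \<and>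
     (\<forall>w::real. w > 0 \<longrightarrow>
        F (\<i> * of_real w) = of_real a + \<i> * of_real b * of_real w +
          (CLINT x|\<rho>. (\<i> * of_real w * of_real x - 1) / (\<i> * of_real w + of_real x)))"

text \<open>
  The characteristics are the \<^emph>\<open>unique\<close> triple with this representation, so uniqueness
  is part of the predicate.
\<close>

definition characteristics ::
    "(complex \<Rightarrow> complex) \<Rightarrow> real \<Rightarrow> real \<Rightarrow> real measure \<Rightarrow> bool" where
  "characteristics F a b \<rho> \<longleftrightarrow>
     has_representation F a b \<rho> \<and>
     (\<forall>a' b' \<rho>'. has_representation F a' b' \<rho>' \<longrightarrow> a' = a \<and> b' = b \<and> \<rho>' = \<rho>)"

text \<open>Meaningful for \<open>s \<noteq> 0\<close> only: \<open>ln\<close> and \<open>Ei\<close> are singular at \<open>0\<close>.\<close>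

definition fourier_T :: "real \<Rightarrow> real" where
  "fourier_T s =
     pi / 2 * exp (- \<bar>s\<bar>) + 2 * sinh \<bar>s\<bar> * arctan (exp (- \<bar>s\<bar>))
     + cosh s * ln ((1 - exp (- \<bar>s\<bar>)) / (1 + exp (- \<bar>s\<bar>)))
     - (exp (- s) * Ei s + exp s * Ei (- s)) / 2"

end

theory Submission
  imports Defs "HOL-Real_Asymp.Real_Asymp"
begin

text \<open>
  Everything rests on the function \<open>k u = 1 / u - 2 / sinh (2 * u)\<close>, called \<open>csch_kernel\<close> below,
  which has two integral descriptions.

  \<^item> It is a Laplace density: \<open>\<psi>(w/2) + \<beta>(w/2) - ln (w/2)\<close> is the integral of \<open>exp (- w u) k u\<close>
    over \<open>u > 0\<close> (\<open>Digamma_beta_Laplace\<close>). This is Gauss' integral for \<open>\<psi>\<close> together with the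
    definition of \<open>\<beta>\<close>, since \<open>1/t - 1/(1 - exp (-t)) + 1/(1 + exp (-t)) = 1/t - 1/sinh t\<close>.
  \<^item> It is a sine transform: \<open>k s\<close> is the integral of \<open>2 sin (s x) / (exp (\<pi> x / 2) + 1)\<close> over \<open>x > 0\<close>
    (\<open>csch_kernel_sine_transform\<close>), which is the partial fraction expansion of \<open>coth\<close> in disguise.

  Integrate the sine transform against a weight \<open>c u\<close> and exchange the integrals
  (\<open>csch_kernel_weighted_integral\<close>). The weight \<open>exp (- w u)\<close> has sine transform \<open>x / (w\<^sup>2 + x\<^sup>2)\<close>
  and gives \<open>F_T(i w) = i w \<integral> 2 x / ((w\<^sup>2 + x\<^sup>2) (exp (\<pi> x / 2) + 1)) dx\<close>. As the odd part of the
  kernel \<open>(i w x - 1) / (i w + x)\<close> cancels against an even density, this is the representation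
  with \<open>a = b = 0\<close> for the measure with density \<open>|x| / ((1 + x\<^sup>2) (exp (\<pi> |x| / 2) + 1))\<close>, whose Fourier
  transform is visibly the stated cosine integral.

  A second weight, built from \<open>exp (- \<bar>u - s\<bar>)\<close> and \<open>exp (- u - s)\<close>, has sine transform
  \<open>x cos (s x) / (1 + x\<^sup>2)\<close>. It turns the cosine integral into integrals of
  \<open>exp (- u) k u\<close> and \<open>exp u k u\<close>, and these have antiderivatives made of \<open>Ei\<close>, \<open>ln\<close> and
  \<open>arctan\<close>. The closed form follows (\<open>cosine_T_eq_fourier_T_pos\<close>). The constant \<open>\<gamma>\<close> in the total mass comes from
  the expansion \<open>Ei x = \<gamma> + ln \<bar>x\<bar> + o(1)\<close> at \<open>0\<close>, and thus ultimately from \<open>\<psi>(1) = - \<gamma>\<close>.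

  The characteristics are unique (\<open>representation_unique\<close>) because the kernel is \<open>i w\<close> plus \<open>i (1 - w\<^sup>2)\<close>
  times the resolvent \<open>1 / (w - i x)\<close>, and the integral of the resolvent is the Laplace transform of
  the characteristic function at \<open>w\<close>. So \<open>w = 1\<close> determines \<open>a\<close> and the sum of \<open>b\<close> and the mass, while
  \<open>w = 2, 3, \<dots>\<close> determine the characteristic function by the theorem of Weierstrass, hence the measure
  by that of Levy.
\<close>

section \<open>Tools for integration on half-lines\<close>

lemma Fubini_product_bound:
  fixes f :: "'a \<Rightarrow> 'b \<Rightarrow> 'c :: {banach, second_countable_topology}"
    and A :: "'a \<Rightarrow> real" and B :: "'b \<Rightarrow> real"
  assumes "pair_sigma_finite M N"
    and meas [measurable]: "case_prod f \<in> borel_measurable (M \<Otimes>\<^sub>M N)"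
    and A: "integrable M A" and B: "integrable N B"
    and bound: "\<And>x y. x \<in> space M \<Longrightarrow> y \<in> space N \<Longrightarrow> norm (f x y) \<le> A x * B y"
  shows "integrable (M \<Otimes>\<^sub>M N) (case_prod f)"
    and "(LINT y|N. LINT x|M. f x y) = (LINT x|M. LINT y|N. f x y)"
proof -
  interpret pair_sigma_finite M N by fact
  have [measurable]: "A \<in> borel_measurable M" "B \<in> borel_measurable N"
    using A B by auto
  have "integrable (M \<Otimes>\<^sub>M N) (\<lambda>(x, y). A x * B y)"
  proof (rule Fubini_integrable)
    show "integrable M (\<lambda>x. LINT y|N. norm (case (x, y) of (x, y) \<Rightarrow> A x * B y))"
      using A by (simp add: abs_mult)
    show "AE x in M. integrable N (\<lambda>y. case (x, y) of (x, y) \<Rightarrow> A x * B y)"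
      using B by simp
  qed measurable
  then show *: "integrable (M \<Otimes>\<^sub>M N) (case_prod f)"
  proof (rule Bochner_Integration.integrable_bound)
    show "AE p in M \<Otimes>\<^sub>M N. norm (case_prod f p) \<le> norm (case p of (x, y) \<Rightarrow> A x * B y)"
      using bound by (intro AE_I2) (auto simp: space_pair_measure intro: order_trans[OF _ abs_ge_self])
  qed measurable
  show "(LINT y|N. LINT x|M. f x y) = (LINT x|M. LINT y|N. f x y)"
    by (rule Fubini_integral[OF *])
qed

lemma FTC_Ioi_nonneg:
  fixes f F :: "real \<Rightarrow> real"
  assumes F: "\<And>x. a < x \<Longrightarrow> (F has_real_derivative f x) (at x)"
    and f: "\<And>x. a < x \<Longrightarrow> isCont f x" "\<And>x. a < x \<Longrightarrow> 0 \<le> f x"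
    and A: "(F \<longlongrightarrow> A) (at_right a)" and B: "(F \<longlongrightarrow> B) at_top"
  shows "set_integrable lborel {a<..} f" and "(LINT x:{a<..}|lborel. f x) = B - A"
proof -
  have A': "((F \<circ> real_of_ereal) \<longlongrightarrow> A) (at_right (ereal a))"
    using A by (simp add: ereal_tendsto_simps)
  have B': "((F \<circ> real_of_ereal) \<longlongrightarrow> B) (at_left \<infinity>)"
    using B by (simp add: ereal_tendsto_simps)
  have lt: "ereal a < \<infinity>" by simp
  note ftc = interval_integral_FTC_nonneg[OF lt _ _ _ A' B', of f]
  show "set_integrable lborel {a<..} f"
    using ftc(1) F f by (simp add: eventually_mono)
  show "(LINT x:{a<..}|lborel. f x) = B - A"
    using ftc(2) F f by (simp add: interval_lebesgue_integral_def)
qed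

lemma FTC_Ioo_nonneg:
  fixes f F :: "real \<Rightarrow> real"
  assumes "a < b"
    and F: "\<And>x. a < x \<Longrightarrow> x < b \<Longrightarrow> (F has_real_derivative f x) (at x)"
    and f: "\<And>x. a < x \<Longrightarrow> x < b \<Longrightarrow> isCont f x" "\<And>x. a < x \<Longrightarrow> x < b \<Longrightarrow> 0 \<le> f x"
    and A: "(F \<longlongrightarrow> A) (at_right a)" and B: "(F \<longlongrightarrow> B) (at_left b)"
  shows "set_integrable lborel {a<..<b} f" and "(LINT x:{a<..<b}|lborel. f x) = B - A"
proof -
  have A': "((F \<circ> real_of_ereal) \<longlongrightarrow> A) (at_right (ereal a))"
    using A by (simp add: ereal_tendsto_simps)
  have B': "((F \<circ> real_of_ereal) \<longlongrightarrow> B) (at_left (ereal b))"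
    using B by (simp add: ereal_tendsto_simps)
  have lt: "ereal a < ereal b" using assms by simp
  note ftc = interval_integral_FTC_nonneg[OF lt _ _ _ A' B', of f]
  show "set_integrable lborel {a<..<b} f"
    using ftc(1) F f by (simp add: eventually_mono)
  show "(LINT x:{a<..<b}|lborel. f x) = B - A"
    using ftc(2) F f assms(1) by (simp add: interval_lebesgue_integral_def)
qed

lemma exp_neg_integrable_Ioi:
  fixes c :: real assumes "c > 0"
  shows "set_integrable lborel {a<..} (\<lambda>t. exp (- (c * t)))"
proof (rule FTC_Ioi_nonneg(1))
  show "((\<lambda>t. - exp (- (c * t)) / c) has_real_derivative exp (- (c * t))) (at t)" for t
    using assms by (auto intro!: derivative_eq_intros)
  show "((\<lambda>t. - exp (- (c * t)) / c) \<longlongrightarrow> - exp (- (c * a)) / c) (at_right a)"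
    using assms by (intro tendsto_intros) auto
  show "((\<lambda>t. - exp (- (c * t)) / c) \<longlongrightarrow> 0) at_top"
    using assms by real_asymp
qed auto

lemma exp_neg_complex_integral_Ioi:
  fixes c :: complex assumes "Re c > 0"
  shows "set_integrable lborel {a<..} (\<lambda>t. exp (- (c * of_real t)))"
    and "(CLINT t:{a<..}|lborel. exp (- (c * of_real t))) = exp (- (c * of_real a)) / c"
proof -
  have c: "c \<noteq> 0" using assms by auto
  show int: "set_integrable lborel {a<..} (\<lambda>t. exp (- (c * of_real t)))"
    by (rule set_integrable_bound[OF exp_neg_integrable_Ioi[OF assms, of a]])
       (auto simp: set_borel_measurable_def)
  have "(LBINT t=ereal a..\<infinity>. exp (- (c * of_real t))) = 0 - (- exp (- (c * of_real a)) / c)"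
  proof (rule interval_integral_FTC_integrable)
    show "((\<lambda>t. - exp (- (c * of_real t)) / c) has_vector_derivative exp (- (c * of_real t))) (at t)" for t
      using c by (auto intro!: derivative_eq_intros has_vector_derivative_real_field)
    show "(((\<lambda>t. - exp (- (c * of_real t)) / c) \<circ> real_of_ereal) \<longlongrightarrow> - exp (- (c * of_real a)) / c)
        (at_right (ereal a))"
      unfolding ereal_tendsto_simps using c by (intro tendsto_intros)
    have "((\<lambda>t. exp (- (r * t)) / b) \<longlongrightarrow> 0) at_top" if "r > 0" "b > 0" for r b :: real
      using that by real_asymp
    from this[of "Re c" "norm c"] have "((\<lambda>t. exp (- (Re c * t)) / norm c) \<longlongrightarrow> 0) at_top"
      using assms c by simp
    then have "((\<lambda>t. - exp (- (c * of_real t)) / c) \<longlongrightarrow> 0) at_top"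
      by (rule tendsto_norm_zero_cancel[OF Lim_transform_eventually])
         (auto simp: norm_divide intro!: always_eventually)
    then show "(((\<lambda>t. - exp (- (c * of_real t)) / c) \<circ> real_of_ereal) \<longlongrightarrow> 0) (at_left \<infinity>)"
      by (simp add: ereal_tendsto_simps)
  qed (use int in auto)
  then show "(CLINT t:{a<..}|lborel. exp (- (c * of_real t))) = exp (- (c * of_real a)) / c"
    by (simp add: interval_lebesgue_integral_def)
qed

lemma exp_neg_integral_Ioi:
  fixes c :: real assumes "c > 0"
  shows "(LINT t:{a<..}|lborel. exp (- (c * t))) = exp (- (c * a)) / c"
proof -
  have "of_real (LINT t:{a<..}|lborel. exp (- (c * t))) = (CLINT t:{a<..}|lborel. exp (- (of_real c * of_real t)))"
    by (simp add: set_integral_complex_of_real[symmetric] exp_of_real[symmetric])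
  also have "\<dots> = of_real (exp (- (c * a)) / c)"
    using exp_neg_complex_integral_Ioi(2)[of "of_real c" a] assms by (simp add: exp_of_real[symmetric])
  finally show ?thesis by (simp only: of_real_eq_iff)
qed

lemma set_integral_Ici_eq_Ioi:
  fixes f :: "real \<Rightarrow> 'a::{banach, second_countable_topology}"
  shows "(LINT x:{a..}|lborel. f x) = (LINT x:{a<..}|lborel. f x)"
  by (rule set_integral_discrete_difference[where X="{a}"]) auto

text \<open>Frullani's integral: the integrand is the integral of \<open>exp (- y t)\<close> over \<open>y\<close> from \<open>z\<close> to \<open>z + m\<close>, so
  exchanging the integrals leaves the integral of \<open>1 / y\<close>.\<close>

lemma frullani_exp:
  fixes z m :: real assumes "z > 0" "m \<ge> 0"
  shows "set_integrable lborel {0<..} (\<lambda>t. exp (- (z * t)) * (1 - exp (- (m * t))) / t)"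
    and "(LINT t:{0<..}|lborel. exp (- (z * t)) * (1 - exp (- (m * t))) / t) = ln ((z + m) / z)"
proof -
  let ?g = "\<lambda>t y::real. indicator {0<..} t * (indicator {z..z+m} y * exp (- (y * t)))"
  have int1: "integrable lborel (\<lambda>t. indicator {0<..} t * exp (- (z * t)))"
    using exp_neg_integrable_Ioi[OF assms(1), of 0] by (simp add: set_integrable_def)
  have int2: "integrable lborel (indicator {z..z+m} :: real \<Rightarrow> real)"
    using assms by (simp add: integrable_indicator_iff emeasure_lborel_Icc_eq)
  have bnd: "norm (?g t y) \<le> (indicator {0<..} t * exp (- (z * t))) * indicator {z..z+m} y" for t y
    using assms by (auto split: split_indicator)
  have ps: "pair_sigma_finite lborel (lborel :: real measure)" ..
  have meas: "case_prod ?g \<in> borel_measurable (lborel \<Otimes>\<^sub>M lborel)" by measurable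
  note fub = Fubini_product_bound[OF ps meas int1 int2 bnd]
  have inner: "(LINT y|lborel. ?g t y) = indicator {0<..} t *\<^sub>R (exp (- (z * t)) * (1 - exp (- (m * t))) / t)" for t
  proof (cases "t > 0")
    case True
    have "(LINT y|lborel. exp (- (y * t)) * indicator {z..z+m} y) = - exp (- ((z+m) * t)) / t - (- exp (- (z * t)) / t)"
      by (rule integral_FTC_Icc_real) (use assms True in \<open>auto intro!: derivative_eq_intros\<close>)
    then show ?thesis using True by (simp add: field_simps exp_add exp_diff exp_minus)
  qed auto
  have inner2: "(LINT t|lborel. ?g t y) = indicator {z..z+m} y * (1 / y)" for y
    using exp_neg_integral_Ioi[of y 0] assms
    by (auto simp: set_lebesgue_integral_def mult.commute split: split_indicator)
  show "set_integrable lborel {0<..} (\<lambda>t. exp (- (z * t)) * (1 - exp (- (m * t))) / t)"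
    using lborel_pair.integrable_fst'[OF fub(1)] unfolding set_integrable_def by (simp only: prod.case inner)
  have "(LINT t:{0<..}|lborel. exp (- (z * t)) * (1 - exp (- (m * t))) / t) = (LINT t|lborel. LINT y|lborel. ?g t y)"
    unfolding set_lebesgue_integral_def inner ..
  also have "\<dots> = (LINT y|lborel. LINT t|lborel. ?g t y)" using fub(2) by simp
  also have "\<dots> = (LINT y|lborel. (1 / y) * indicator {z..z+m} y)" unfolding inner2 by (simp add: mult.commute)
  also have "\<dots> = ln (z + m) - ln z"
    by (rule integral_FTC_Icc_real) (use assms in \<open>auto intro!: derivative_eq_intros continuous_intros simp: field_simps\<close>)
  finally show "(LINT t:{0<..}|lborel. exp (- (z * t)) * (1 - exp (- (m * t))) / t) = ln ((z + m) / z)"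
    using assms by (simp add: ln_div)
qed

section \<open>Laplace integrals for the digamma and beta functions\<close>

text \<open>Both bounds are instances of \<open>1 + x \<le> exp x\<close>. They make \<open>exp (- z t)\<close> a dominating function for
  the integral of \<open>\<psi>\<close> and for its approximations.\<close>

lemma exp_kernel_bounds:
  fixes t :: real assumes "t > 0"
  shows "1 / t - 1 / (1 - exp (- t)) \<le> 0" and "- 1 \<le> 1 / t - 1 / (1 - exp (- t))"
proof -
  have pos: "0 < 1 - exp (- t)" using assms by simp
  have "1 - exp (- t) \<le> t" using exp_ge_add_one_self[of "- t"] by simp
  then show "1 / t - 1 / (1 - exp (- t)) \<le> 0"
    using pos assms by (simp add: frac_le)
  have "exp (- t) * (1 + t) \<le> exp (- t) * exp t"
    using exp_ge_add_one_self[of t] by (intro mult_left_mono) auto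
  then have "t \<le> (1 + t) * (1 - exp (- t))"
    by (simp add: algebra_simps exp_minus)
  then show "- 1 \<le> 1 / t - 1 / (1 - exp (- t))"
    using pos assms by (simp add: field_simps)
qed

text \<open>Gauss' integral. Inserting the factor \<open>1 - exp (- m t)\<close> cuts the geometric series
  \<open>1 / (1 - exp (- t))\<close> after \<open>m\<close> terms and turns \<open>1 / t\<close> into a Frullani integral. The truncated integral is
  therefore \<open>ln ((z + m) / z) - (\<Sum>n<m. 1 / (z + n))\<close>, which tends to \<open>\<psi>(z) - ln z\<close> by the limit formula
  for \<open>\<psi>\<close>.\<close>

lemma Digamma_minus_ln_integral:
  fixes z :: real assumes z: "z > 0"
  shows "set_integrable lborel {0<..} (\<lambda>t. exp (- (z * t)) * (1 / t - 1 / (1 - exp (- t))))"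
    and "(LINT t:{0<..}|lborel. exp (- (z * t)) * (1 / t - 1 / (1 - exp (- t)))) = Digamma z - ln z"
proof -
  let ?h = "\<lambda>t::real. 1 / t - 1 / (1 - exp (- t))"
  let ?s = "\<lambda>m t. exp (- (z * t)) * (1 - exp (- (real m * t))) * ?h t"
  have bnd: "\<bar>?h t\<bar> \<le> 1" if "t > 0" for t
    using exp_kernel_bounds[OF that] by linarith
  have int_exp: "set_integrable lborel {0<..} (\<lambda>t. exp (- (z * t)))"
    by (rule exp_neg_integrable_Ioi[OF z])
  show "set_integrable lborel {0<..} (\<lambda>t. exp (- (z * t)) * ?h t)"
    by (rule set_integrable_bound[OF int_exp])
       (use bnd in \<open>auto simp: set_borel_measurable_def abs_mult intro!: AE_I2 mult_left_le\<close>)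
  have partial: "(LINT t:{0<..}|lborel. ?s m t) = ln ((z + m) / z) - (\<Sum>n<m. inverse (z + real n))" for m
  proof -
    have eq: "?s m t = exp (- (z * t)) * (1 - exp (- (real m * t))) / t - (\<Sum>n<m. exp (- ((z + real n) * t)))"
      if "t > 0" for t
    proof -
      have "(\<Sum>n<m. exp (- ((z + real n) * t))) = exp (- (z * t)) * (\<Sum>n<m. exp (- t) ^ n)"
        by (simp add: sum_distrib_left exp_of_nat_mult[symmetric] exp_add[symmetric] algebra_simps)
      also have "(\<Sum>n<m. exp (- t) ^ n) = (1 - exp (- (real m * t))) / (1 - exp (- t))"
        using that exp_of_nat_mult[of m "- t"] by (simp add: sum_gp_strict)
      finally have "(\<Sum>n<m. exp (- ((z + real n) * t))) = exp (- (z * t)) * ((1 - exp (- (real m * t))) / (1 - exp (- t)))" .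
      then show ?thesis by (simp only:) (simp add: right_diff_distrib)
    qed
    have int: "set_integrable lborel {0<..} (\<lambda>t. exp (- ((z + real n) * t)))" for n
      using z by (intro exp_neg_integrable_Ioi) auto
    have int_sum: "set_integrable lborel {0<..} (\<lambda>t. (\<Sum>n<m. exp (- ((z + real n) * t))))"
      using int unfolding set_integrable_def scaleR_sum_right by (intro Bochner_Integration.integrable_sum)
    have "(LINT t:{0<..}|lborel. ?s m t) = (LINT t:{0<..}|lborel.
        exp (- (z * t)) * (1 - exp (- (real m * t))) / t - (\<Sum>n<m. exp (- ((z + real n) * t))))"
      by (rule set_lebesgue_integral_cong) (use eq in auto)
    also have "\<dots> = ln ((z + m) / z) - (LINT t:{0<..}|lborel. (\<Sum>n<m. exp (- ((z + real n) * t))))"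
      using frullani_exp[OF z, of "real m"] int_sum by (subst set_integral_diff) auto
    also have "(LINT t:{0<..}|lborel. (\<Sum>n<m. exp (- ((z + real n) * t)))) = (\<Sum>n<m. inverse (z + real n))"
    proof -
      have "(LINT t:{0<..}|lborel. (\<Sum>n<m. exp (- ((z + real n) * t)))) =
          (\<Sum>n<m. LINT t:{0<..}|lborel. exp (- ((z + real n) * t)))"
        using int unfolding set_lebesgue_integral_def set_integrable_def scaleR_sum_right
        by (intro Bochner_Integration.integral_sum) auto
      also have "\<dots> = (\<Sum>n<m. inverse (z + real n))"
        using z by (intro sum.cong refl, subst exp_neg_integral_Ioi) (auto simp: inverse_eq_divide)
      finally show ?thesis .
    qed
    finally show ?thesis .
  qed
  have "(\<lambda>m. LINT t:{0<..}|lborel. ?s m t) \<longlonglongrightarrow> (LINT t:{0<..}|lborel. exp (- (z * t)) * ?h t)"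
    unfolding set_lebesgue_integral_def
  proof (rule integral_dominated_convergence)
    show "integrable lborel (\<lambda>t. indicator {0<..} t *\<^sub>R exp (- (z * t)))"
      using int_exp by (simp add: set_integrable_def)
    have lim: "(\<lambda>m. ?s m t) \<longlonglongrightarrow> exp (- (z * t)) * (1 - 0) * ?h t" if "t > 0" for t
    proof -
      have "(\<lambda>m. exp (- (real m * t))) \<longlonglongrightarrow> 0" using that by real_asymp
      then show ?thesis by (intro tendsto_intros)
    qed
    show "AE t in lborel. (\<lambda>m. indicator {0<..} t *\<^sub>R ?s m t) \<longlonglongrightarrow> indicator {0<..} t *\<^sub>R (exp (- (z * t)) * ?h t)"
      using lim by (intro AE_I2) (auto split: split_indicator)
    show "AE t in lborel. norm (indicator {0<..} t *\<^sub>R ?s m t) \<le> indicator {0<..} t *\<^sub>R exp (- (z * t))" for m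
    proof (intro AE_I2)
      fix t :: real
      have "\<bar>1 - exp (- (real m * t))\<bar> * \<bar>?h t\<bar> \<le> 1 * 1" if "t > 0"
        using bnd[OF that] that by (intro mult_mono) auto
      then show "norm (indicator {0<..} t *\<^sub>R ?s m t) \<le> indicator {0<..} t *\<^sub>R exp (- (z * t))"
        by (auto simp: abs_mult mult.assoc intro!: mult_left_le split: split_indicator)
    qed
  qed measurable
  moreover have "(\<lambda>m. LINT t:{0<..}|lborel. ?s m t) \<longlonglongrightarrow> Digamma z - ln z"
  proof -
    have "(\<lambda>m. ln ((z + real m) / z) - ln m) \<longlonglongrightarrow> ln (inverse z)"
      using z by real_asymp
    moreover have "(\<lambda>m. ln (real m) - (\<Sum>n<m. inverse (z + real n))) \<longlonglongrightarrow> Digamma z"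
      using Digamma_LIMSEQ[of z] z by simp
    ultimately have "(\<lambda>m. (ln ((z + real m) / z) - ln m) + (ln (real m) - (\<Sum>n<m. inverse (z + real n))))
        \<longlonglongrightarrow> ln (inverse z) + Digamma z" by (rule tendsto_add)
    then show ?thesis unfolding partial using z by (simp add: ln_inverse)
  qed
  ultimately show "(LINT t:{0<..}|lborel. exp (- (z * t)) * ?h t) = Digamma z - ln z"
    by (rule LIMSEQ_unique)
qed

lemma beta_fun_of_real:
  fixes z :: real assumes z: "z > 0"
  shows "set_integrable lborel {0<..} (\<lambda>t. exp (- (z * t)) / (1 + exp (- t)))"
    and "beta_fun (of_real z) = of_real (LINT t:{0<..}|lborel. exp (- (z * t)) / (1 + exp (- t)))"
proof -
  show "set_integrable lborel {0<..} (\<lambda>t. exp (- (z * t)) / (1 + exp (- t)))"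
    by (rule set_integrable_bound[OF exp_neg_integrable_Ioi[OF z, of 0]])
       (auto simp: set_borel_measurable_def add_pos_pos intro!: AE_I2 divide_le_eq_1[THEN iffD2] simp: divide_le_eq)
  have "exp (- of_real z * of_real x) / (1 + exp (- of_real x)) =
      (of_real (exp (- (z * x)) / (1 + exp (- x))) :: complex)" for x
    by (simp add: exp_of_real[symmetric])
  then show "beta_fun (of_real z) = of_real (LINT t:{0<..}|lborel. exp (- (z * t)) / (1 + exp (- t)))"
    unfolding beta_fun_def set_integral_Ici_eq_Ioi by (simp only: set_integral_complex_of_real)
qed

lemma sinh_ge_self:
  fixes x :: real assumes "x \<ge> 0" shows "x \<le> sinh x"
proof -
  have "sinh 0 - 0 \<le> sinh x - x"
  proof (rule DERIV_nonneg_imp_nondecreasing[of 0 x "\<lambda>u. sinh u - u"])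
    fix u :: real
    show "\<exists>y. ((\<lambda>u. sinh u - u) has_real_derivative y) (at u) \<and> 0 \<le> y"
      using cosh_real_ge_1[of u]
      by (intro exI[of _ "cosh u - 1"]) (auto intro!: derivative_eq_intros)
  qed (use assms in auto)
  then show ?thesis by simp
qed

definition csch_kernel :: "real \<Rightarrow> real" where
  "csch_kernel u = 1 / u - 2 / sinh (2 * u)"

lemma csch_kernel_measurable [measurable]: "csch_kernel \<in> borel_measurable borel"
  unfolding csch_kernel_def sinh_def by measurable

lemma csch_kernel_nonneg: "0 \<le> csch_kernel u" if "u > 0"
proof -
  have "2 * u \<le> sinh (2 * u)" using that by (intro sinh_ge_self) simp
  then have "2 / sinh (2 * u) \<le> 2 / (2 * u)"
    using that by (intro divide_left_mono) auto
  then show ?thesis by (simp add: csch_kernel_def)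
qed

text \<open>The two Laplace densities add up to \<open>1 / t - 1 / sinh t\<close>, and the substitution \<open>t = 2 u\<close> gives the kernel.\<close>

lemma Digamma_beta_Laplace:
  fixes w :: real assumes w: "w > 0"
  shows "of_real (LINT u:{0<..}|lborel. exp (- (w * u)) * csch_kernel u) =
    Digamma (of_real (w / 2)) + beta_fun (of_real (w / 2)) - of_real (ln (w / 2))"
proof -
  define z where "z = w / 2"
  have z: "z > 0" using w by (simp add: z_def)
  let ?f = "\<lambda>t::real. exp (- (z * t)) * (1 / t - 1 / sinh t)"
  have eq: "?f t = exp (- (z * t)) * (1 / t - 1 / (1 - exp (- t))) + exp (- (z * t)) / (1 + exp (- t))"
    if "t > 0" for t
  proof -
    have ne: "1 - exp (- t) \<noteq> 0" "1 + exp (- t) \<noteq> 0" 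
      using that by (auto simp: add_pos_pos less_imp_neq[THEN not_sym])
    have "1 / sinh t = 2 * exp (- t) / (1 - exp (- t) * exp (- t))"
      using that by (simp add: sinh_field_def field_simps exp_minus)
    also have "1 - exp (- t) * exp (- t) = (1 - exp (- t)) * (1 + exp (- t))"
      by (simp add: algebra_simps)
    also have "2 * exp (- t) / \<dots> = 1 / (1 - exp (- t)) - 1 / (1 + exp (- t))"
      using ne by (simp add: divide_simps)
    finally have "1 / t - 1 / sinh t = (1 / t - 1 / (1 - exp (- t))) + 1 / (1 + exp (- t))" by simp
    then show ?thesis by (simp only: distrib_left) simp
  qed
  have "(LINT t:{0<..}|lborel. ?f t) = (LINT t:{0<..}|lborel.
      exp (- (z * t)) * (1 / t - 1 / (1 - exp (- t))) + exp (- (z * t)) / (1 + exp (- t)))"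
    by (rule set_lebesgue_integral_cong) (use eq in auto)
  also have "\<dots> = Digamma z - ln z + (LINT t:{0<..}|lborel. exp (- (z * t)) / (1 + exp (- t)))"
    using Digamma_minus_ln_integral[OF z] beta_fun_of_real(1)[OF z] by simp
  finally have 1: "of_real (LINT t:{0<..}|lborel. ?f t) = Digamma (of_real z) + beta_fun (of_real z) - of_real (ln z)"
    using Polygamma_of_real[where 'a=complex, of z 0] z beta_fun_of_real(2)[OF z] by simp
  have "(LINT t:{0<..}|lborel. ?f t) = \<bar>2\<bar> *\<^sub>R (LINT u|lborel. indicator {0<..} (0 + 2 * u) *\<^sub>R ?f (0 + 2 * u))"
    unfolding set_lebesgue_integral_def by (rule lborel_integral_real_affine) simp
  also have "\<dots> = (LINT u|lborel. 2 * (indicator {0<..} (0 + 2 * u) *\<^sub>R ?f (0 + 2 * u)))"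
    by simp
  also have "\<dots> = (LINT u:{0<..}|lborel. exp (- (w * u)) * csch_kernel u)"
    unfolding set_lebesgue_integral_def
    by (rule Bochner_Integration.integral_cong)
       (auto simp: indicator_def z_def csch_kernel_def field_simps zero_less_mult_iff)
  finally show ?thesis using 1 by (simp add: z_def)
qed

section \<open>The kernel as a sine transform\<close>

text \<open>The logarithmic derivative of the reflection formula of \<open>\<Gamma>\<close>, taken for \<open>1 / \<Gamma>\<close>, which is entire.\<close>

lemma Digamma_reflection_complex:
  fixes z :: complex assumes "z \<notin> \<int>"
  shows "Digamma (1 - z) - Digamma z = of_real pi * cot (of_real pi * z)"
proof -
  have z: "z \<notin> \<int>\<^sub>\<le>\<^sub>0" "1 - z \<notin> \<int>\<^sub>\<le>\<^sub>0"
    using assms nonpos_Ints_subset_Ints[where 'a=complex] Ints_diff[of 1 "1 - z"] by auto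
  have "((\<lambda>z. rGamma z * rGamma (1 - z)) has_field_derivative
      rGamma z * rGamma (1 - z) * (Digamma (1 - z) - Digamma z)) (at z)"
    using z by (auto intro!: derivative_eq_intros DERIV_chain' simp: algebra_simps)
  moreover have "((\<lambda>z. sin (of_real pi * z) / of_real pi) has_field_derivative cos (of_real pi * z)) (at z)"
    by (auto intro!: derivative_eq_intros)
  ultimately have "rGamma z * rGamma (1 - z) * (Digamma (1 - z) - Digamma z) = cos (of_real pi * z)"
    unfolding rGamma_reflection_complex by (rule DERIV_unique)
  moreover have "sin (of_real pi * z) \<noteq> 0"
  proof
    assume "sin (of_real pi * z) = 0"
    then have "rGamma z * rGamma (1 - z) = 0" by (simp add: rGamma_reflection_complex)
    with z show False by (auto simp: rGamma_eq_zero_iff)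
  qed
  ultimately show ?thesis
    by (simp add: rGamma_reflection_complex cot_def field_simps)
qed

text \<open>This is the reflection formula of \<open>\<psi>\<close> at \<open>z = \<i> y\<close>. With \<open>\<psi>(1 + z)\<close> in place of \<open>\<psi>(z)\<close> the series for
  the two digamma values run over the same indices, and each pair of terms is real up to a factor \<open>\<i>\<close>.\<close>

lemma coth_partial_fractions:
  fixes y :: real assumes "y > 0"
  shows "(\<lambda>n. 2 * y / ((real n + 1)\<^sup>2 + y\<^sup>2)) sums (pi * (cosh (pi * y) / sinh (pi * y)) - 1 / y)"
proof -
  define z where "z = \<i> * complex_of_real y"
  have y: "y \<noteq> 0" using assms by simp
  have Im: "Im z \<noteq> 0" using assms by (simp add: z_def)
  then have zZ: "z \<notin> \<int>" by (auto simp: complex_is_Int_iff)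
  have nz: "z + of_nat k \<noteq> 0" "of_nat k - z \<noteq> 0" "z \<noteq> 0" for k
    using Im by (auto simp: complex_eq_iff)
  have dig: "(\<lambda>k. inverse (of_nat (Suc k)) - inverse (w + of_nat k)) sums (Digamma w + euler_mascheroni)"
    if "w \<noteq> 0" for w :: complex
    using summable_sums[OF summable_Digamma[OF that]] by (simp add: Digamma_def)
  have "(\<lambda>k. inverse (1 + z + of_nat k) - inverse (1 - z + of_nat k)) sums (Digamma (1 - z) - Digamma (1 + z))"
    using sums_diff[OF dig[of "1 - z"] dig[of "1 + z"]] Im by (auto simp: complex_eq_iff)
  also have "Digamma (1 - z) - Digamma (1 + z) = of_real pi * cot (of_real pi * z) - 1 / z"
    using Digamma_reflection_complex[OF zZ] Digamma_plus1[OF nz(3)] by (simp add: algebra_simps)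
  also have "(\<lambda>k. inverse (1 + z + of_nat k) - inverse (1 - z + of_nat k)) =
      (\<lambda>k. - \<i> * of_real (2 * y / ((real k + 1)\<^sup>2 + y\<^sup>2)))"
  proof
    fix k
    have ne: "(real k + 1)\<^sup>2 + y\<^sup>2 \<noteq> 0" using y by (simp add: sum_power2_eq_zero_iff)
    have c: "of_real ((real k + 1)\<^sup>2 + y\<^sup>2) = (1 + z + of_nat k) * (1 - z + of_nat k)"
      by (simp add: z_def algebra_simps power2_eq_square)
    have "inverse (1 + z + of_nat k) - inverse (1 - z + of_nat k) = - 2 * z / of_real ((real k + 1)\<^sup>2 + y\<^sup>2)"
      using nz(1)[of "Suc k"] nz(2)[of "Suc k"] unfolding c by (simp add: field_simps)
    then show "inverse (1 + z + of_nat k) - inverse (1 - z + of_nat k) =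
        - \<i> * of_real (2 * y / ((real k + 1)\<^sup>2 + y\<^sup>2))"
      by (simp add: z_def)
  qed
  finally have "(\<lambda>k. \<i> * (- \<i> * of_real (2 * y / ((real k + 1)\<^sup>2 + y\<^sup>2))))
      sums (\<i> * (of_real pi * cot (of_real pi * z) - 1 / z))"
    by (rule sums_mult)
  moreover have "\<i> * (of_real pi * cot (of_real pi * z) - 1 / z) =
      of_real (pi * (cosh (pi * y) / sinh (pi * y)) - 1 / y)"
  proof -
    have "sin (\<i> * of_real t) = \<i> * of_real (sinh t)" "cos (\<i> * of_real t) = of_real (cosh t)" for t
      by (simp_all add: sin_i_times cosh_complex[symmetric] sinh_field_def cosh_field_def exp_minus
          flip: exp_of_real)
    then have cot: "cot (\<i> * of_real t) = - \<i> * of_real (cosh t / sinh t)" for t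
      by (cases "sinh t = 0") (simp_all add: cot_def field_simps)
    have "of_real pi * z = \<i> * of_real (pi * y)" by (simp add: z_def)
    then have "cot (of_real pi * z) = - \<i> * of_real (cosh (pi * y) / sinh (pi * y))"
      by (simp only: cot)
    moreover have "\<i> * (a * (- \<i> * c)) = a * c" for a c :: complex
      by (simp add: mult.left_commute[of \<i> a])
    ultimately have "\<i> * (of_real pi * cot (of_real pi * z)) = of_real (pi * (cosh (pi * y) / sinh (pi * y)))"
      by (simp only: of_real_mult)
    then show ?thesis using y by (simp add: z_def right_diff_distrib)
  qed
  ultimately have "(\<lambda>k. complex_of_real (2 * y / ((real k + 1)\<^sup>2 + y\<^sup>2)))
      sums of_real (pi * (cosh (pi * y) / sinh (pi * y)) - 1 / y)"
    by (simp add: mult.assoc[symmetric])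
  then show ?thesis by (simp only: sums_of_real_iff)
qed

lemma sin_exp_integral_Ioi:
  fixes a c s :: real assumes "c > 0"
  shows "set_integrable lborel {a<..} (\<lambda>x. exp (- (c * x)) * sin (s * x))"
    and "(LINT x:{a<..}|lborel. exp (- (c * x)) * sin (s * x)) =
      exp (- (c * a)) * (c * sin (s * a) + s * cos (s * a)) / (c\<^sup>2 + s\<^sup>2)"
proof -
  define z where "z = Complex c (- s)"
  have z: "Re z > 0" using assms by (simp add: z_def)
  note E = exp_neg_complex_integral_Ioi[OF z, of a]
  have Im: "Im (exp (- (z * of_real x))) = exp (- (c * x)) * sin (s * x)" for x
    by (simp add: Im_exp z_def)
  show "set_integrable lborel {a<..} (\<lambda>x. exp (- (c * x)) * sin (s * x))"
    using integrable_Im[OF E(1)[unfolded set_integrable_def]] by (simp add: set_integrable_def Im)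
  have "(LINT x:{a<..}|lborel. exp (- (c * x)) * sin (s * x)) =
      Im (CLINT x:{a<..}|lborel. exp (- (z * of_real x)))"
    using integral_Im[OF E(1)[unfolded set_integrable_def]] by (simp add: set_lebesgue_integral_def Im)
  also have "\<dots> = exp (- (c * a)) * (c * sin (s * a) + s * cos (s * a)) / (c\<^sup>2 + s\<^sup>2)"
    unfolding E(2) by (simp add: z_def Im_divide Im_exp Re_exp algebra_simps)
  finally show "(LINT x:{a<..}|lborel. exp (- (c * x)) * sin (s * x)) =
      exp (- (c * a)) * (c * sin (s * a) + s * cos (s * a)) / (c\<^sup>2 + s\<^sup>2)" .
qed

text \<open>Equivalent to \<open>x / 2 \<le> sinh (x / 2)\<close>; the factor \<open>x\<close>, supplied by \<open>\<bar>sin (s x)\<bar> \<le> s x\<close>,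
  cancels the pole of \<open>1 / (exp x - 1)\<close> at \<open>0\<close>.\<close>

lemma planck_bound:
  fixes x :: real assumes "x > 0" shows "x / (exp x - 1) \<le> exp (- (x / 2))"
proof -
  have "x / 2 \<le> sinh (x / 2)" using assms by (intro sinh_ge_self) simp
  then have "x \<le> exp (x / 2) - exp (- (x / 2))" by (simp add: sinh_field_def)
  then have "exp (x / 2) * x \<le> exp (x / 2) * (exp (x / 2) - exp (- (x / 2)))" by simp
  also have "\<dots> = exp x - 1" by (simp add: algebra_simps exp_add[symmetric])
  finally show ?thesis using assms by (simp add: field_simps exp_minus)
qed

text \<open>Expand \<open>1 / (exp (a x) - 1)\<close> into the geometric series of \<open>exp (- (n + 1) a x)\<close>. Each term integrates to
  a partial fraction of \<open>coth\<close>, and \<open>planck_bound\<close> dominates the partial sums.\<close>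

lemma planck_sine_integral:
  fixes a s :: real assumes a: "a > 0" and s: "s > 0"
  shows "set_integrable lborel {0<..} (\<lambda>x. sin (s * x) / (exp (a * x) - 1))"
    and "(LINT x:{0<..}|lborel. sin (s * x) / (exp (a * x) - 1)) =
      pi / (2 * a) * (cosh (pi * s / a) / sinh (pi * s / a)) - 1 / (2 * s)"
proof -
  let ?b = "\<lambda>x. s / a * exp (- (a / 2 * x))"
  let ?s = "\<lambda>m x. (\<Sum>n<m. exp (- ((real n + 1) * a * x)) * sin (s * x))"
  have bint: "set_integrable lborel {0<..} ?b"
    using a by (intro set_integrable_mult_right exp_neg_integrable_Ioi) auto
  have bound: "\<bar>sin (s * x)\<bar> / (exp (a * x) - 1) \<le> ?b x" if "x > 0" for x
  proof -
    have "\<bar>sin (s * x)\<bar> \<le> s * x" using abs_sin_x_le_abs_x[of "s * x"] s that by simp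
    then have "\<bar>sin (s * x)\<bar> / (exp (a * x) - 1) \<le> s / a * (a * x / (exp (a * x) - 1))"
      using a that by (simp add: divide_right_mono)
    also have "\<dots> \<le> ?b x"
      using planck_bound[of "a * x"] a s that by (intro mult_left_mono) auto
    finally show ?thesis .
  qed
  have geom: "?s m x = sin (s * x) / (exp (a * x) - 1) * (1 - exp (- (a * x)) ^ m)" if "x > 0" for m x
  proof -
    have q: "exp (- (a * x)) < 1" using a that by simp
    have "?s m x = sin (s * x) * (exp (- (a * x)) * (\<Sum>n<m. exp (- (a * x)) ^ n))"
      by (simp add: sum_distrib_left exp_of_nat_mult[symmetric] exp_add[symmetric] algebra_simps)
    also have "(\<Sum>n<m. exp (- (a * x)) ^ n) = (1 - exp (- (a * x)) ^ m) / (1 - exp (- (a * x)))"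
      using q by (subst sum_gp_strict) auto
    also have "exp (- (a * x)) * ((1 - exp (- (a * x)) ^ m) / (1 - exp (- (a * x)))) =
        (1 - exp (- (a * x)) ^ m) / (exp (a * x) - 1)"
      using a that by (simp add: exp_minus divide_simps)
    finally show ?thesis by simp
  qed
  show int: "set_integrable lborel {0<..} (\<lambda>x. sin (s * x) / (exp (a * x) - 1))"
    by (rule set_integrable_bound[OF bint])
       (use bound a s in \<open>auto simp: set_borel_measurable_def intro!: AE_I2 order_trans[OF _ abs_ge_self]\<close>)
  have "(\<lambda>m. LINT x:{0<..}|lborel. ?s m x) \<longlonglongrightarrow> (LINT x:{0<..}|lborel. sin (s * x) / (exp (a * x) - 1))"
    unfolding set_lebesgue_integral_def
  proof (rule integral_dominated_convergence)
    show "integrable lborel (\<lambda>x. indicator {0<..} x *\<^sub>R ?b x)"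
      using bint by (simp add: set_integrable_def)
    have lim: "(\<lambda>m. ?s m x) \<longlonglongrightarrow> sin (s * x) / (exp (a * x) - 1) * (1 - 0)" if "x > 0" for x
      unfolding geom[OF that] using a that by (intro tendsto_intros LIMSEQ_power_zero) auto
    show "AE x in lborel. (\<lambda>m. indicator {0<..} x *\<^sub>R ?s m x) \<longlonglongrightarrow> indicator {0<..} x *\<^sub>R (sin (s * x) / (exp (a * x) - 1))"
      using lim by (intro AE_I2) (auto split: split_indicator)
    have "\<bar>?s m x\<bar> \<le> ?b x" if "x > 0" for m x
    proof -
      have "0 \<le> exp (- (a * x)) ^ m" "exp (- (a * x)) ^ m \<le> 1"
        using a that by (auto intro: power_le_one)
      then have "\<bar>1 - exp (- (a * x)) ^ m\<bar> \<le> 1" by linarith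
      then have "\<bar>?s m x\<bar> \<le> \<bar>sin (s * x)\<bar> / (exp (a * x) - 1)"
        unfolding geom[OF that] using a that by (auto simp: abs_mult intro!: divide_right_mono mult_left_le)
      with bound[OF that] show ?thesis by linarith
    qed
    then show "AE x in lborel. norm (indicator {0<..} x *\<^sub>R ?s m x) \<le> indicator {0<..} x *\<^sub>R ?b x" for m
      by (intro AE_I2) (auto split: split_indicator)
  qed measurable
  moreover have "(LINT x:{0<..}|lborel. ?s m x) = (\<Sum>n<m. 1 / (2 * a) * (2 * (s / a) / ((real n + 1)\<^sup>2 + (s / a)\<^sup>2)))" for m
  proof -
    have I: "set_integrable lborel {0<..} (\<lambda>x. exp (- ((real n + 1) * a * x)) * sin (s * x))" for n
      using a by (intro sin_exp_integral_Ioi) auto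
    have "(LINT x:{0<..}|lborel. ?s m x) =
        (\<Sum>n<m. LINT x:{0<..}|lborel. exp (- ((real n + 1) * a * x)) * sin (s * x))"
      using I unfolding set_lebesgue_integral_def set_integrable_def scaleR_sum_right
      by (intro Bochner_Integration.integral_sum) auto
    also have "\<dots> = (\<Sum>n<m. s / (((real n + 1) * a)\<^sup>2 + s\<^sup>2))"
      using a by (intro sum.cong refl, subst sin_exp_integral_Ioi) auto
    also have "\<dots> = (\<Sum>n<m. 1 / (2 * a) * (2 * (s / a) / ((real n + 1)\<^sup>2 + (s / a)\<^sup>2)))"
    proof (intro sum.cong refl)
      fix n
      have "((real n + 1) * a)\<^sup>2 + s\<^sup>2 = a\<^sup>2 * ((real n + 1)\<^sup>2 + (s / a)\<^sup>2)"
        using a by (simp add: field_simps power2_eq_square)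
      then show "s / (((real n + 1) * a)\<^sup>2 + s\<^sup>2) = 1 / (2 * a) * (2 * (s / a) / ((real n + 1)\<^sup>2 + (s / a)\<^sup>2))"
        using a by (simp add: power2_eq_square)
    qed
    finally show ?thesis .
  qed
  ultimately have "(\<lambda>n. 1 / (2 * a) * (2 * (s / a) / ((real n + 1)\<^sup>2 + (s / a)\<^sup>2))) sums
      (LINT x:{0<..}|lborel. sin (s * x) / (exp (a * x) - 1))"
    by (simp add: sums_def)
  moreover have "(\<lambda>n. 1 / (2 * a) * (2 * (s / a) / ((real n + 1)\<^sup>2 + (s / a)\<^sup>2))) sums
      (1 / (2 * a) * (pi * (cosh (pi * (s / a)) / sinh (pi * (s / a))) - 1 / (s / a)))"
    using a s by (intro sums_mult coth_partial_fractions) auto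
  ultimately have "(LINT x:{0<..}|lborel. sin (s * x) / (exp (a * x) - 1)) =
      1 / (2 * a) * (pi * (cosh (pi * (s / a)) / sinh (pi * (s / a))) - 1 / (s / a))"
    by (rule sums_unique2)
  then show "(LINT x:{0<..}|lborel. sin (s * x) / (exp (a * x) - 1)) =
      pi / (2 * a) * (cosh (pi * s / a) / sinh (pi * s / a)) - 1 / (2 * s)"
    using a by (simp add: right_diff_distrib)
qed

text \<open>Since \<open>1 / (exp y + 1) = 1 / (exp y - 1) - 2 / (exp (2 * y) - 1)\<close>, this is a difference of two
  instances of \<open>planck_sine_integral\<close>. The detour avoids the alternating series of \<open>1 / (exp y + 1)\<close>.\<close>

lemma csch_kernel_sine_transform:
  assumes s: "s > 0"
  shows "(LINT x:{0<..}|lborel. 2 * sin (s * x) / (exp (pi / 2 * x) + 1)) = csch_kernel s"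
proof -
  let ?p = "\<lambda>a x. sin (s * x) / (exp (a * x) - 1)"
  have eq: "2 * sin (s * x) / (exp (pi / 2 * x) + 1) = 2 * ?p (pi / 2) x - 4 * ?p pi x" if "x > 0" for x
  proof -
    have "exp (pi * x) = exp (pi / 2 * x) * exp (pi / 2 * x)" by (simp add: exp_add[symmetric])
    then have e: "exp (pi * x) - 1 = (exp (pi / 2 * x) - 1) * (exp (pi / 2 * x) + 1)"
      by (simp add: algebra_simps)
    have "exp (pi / 2 * x) - 1 > 0" "exp (pi / 2 * x) + 1 > 0" using that by (auto simp: add_pos_pos)
    then show ?thesis unfolding e by (simp add: divide_simps) (simp add: algebra_simps)
  qed
  have "(LINT x:{0<..}|lborel. 2 * sin (s * x) / (exp (pi / 2 * x) + 1)) =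
      (LINT x:{0<..}|lborel. 2 * ?p (pi / 2) x - 4 * ?p pi x)"
    by (rule set_lebesgue_integral_cong) (use eq in auto)
  also have "\<dots> = 2 * (LINT x:{0<..}|lborel. ?p (pi / 2) x) - 4 * (LINT x:{0<..}|lborel. ?p pi x)"
    using planck_sine_integral(1)[of "pi / 2" s] planck_sine_integral(1)[of pi s] s
    by (subst set_integral_diff) (auto intro!: set_integrable_mult_right simp del: times_divide_eq_right)
  also have "\<dots> = 2 * (cosh (2 * s) / sinh (2 * s) - cosh s / sinh s) + 1 / s"
    using s planck_sine_integral(2)[of "pi / 2" s] planck_sine_integral(2)[of pi s]
    by (simp add: right_diff_distrib mult.commute)
  also have "cosh (2 * s) / sinh (2 * s) - cosh s / sinh s = - 1 / sinh (2 * s)"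
  proof -
    have "sinh s \<noteq> 0" "cosh s \<noteq> 0" using s by auto
    moreover have c2: "cosh (2 * s) = 2 * (cosh s)\<^sup>2 - 1"
      using cosh_square_eq[of s] by (simp add: cosh_double)
    ultimately show ?thesis unfolding sinh_double c2 by (simp add: divide_simps power2_eq_square)
  qed
  finally show ?thesis by (simp add: csch_kernel_def)
qed

section \<open>The exponential integral near zero\<close>

text \<open>The entire part of \<open>Ei\<close>. The term for \<open>n = 0\<close> vanishes because \<open>1 / 0 = 0\<close>.\<close>

definition Ein :: "real \<Rightarrow> real" where
  "Ein x = (\<Sum>n. 1 / (real n * fact n) * x ^ n)"

lemma Ein_0 [simp]: "Ein 0 = 0"
  unfolding Ein_def powser_zero by simp

lemma summable_Ein: "summable (\<lambda>n. 1 / (real n * fact n) * y ^ n)" for y :: real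
proof (rule summable_comparison_test)
  show "summable (\<lambda>n. inverse (fact n) * \<bar>y\<bar> ^ n)" by (rule summable_exp)
  show "\<exists>N. \<forall>n\<ge>N. norm (1 / (real n * fact n) * y ^ n) \<le> inverse (fact n) * \<bar>y\<bar> ^ n"
    by (intro exI[of _ 1] allI impI)
      (auto simp: abs_mult power_abs inverse_eq_divide intro!: mult_right_mono frac_le)
qed

lemma DERIV_Ein:
  assumes "x \<noteq> 0"
  shows "(Ein has_real_derivative (exp x - 1) / x) (at x)"
proof -
  let ?c = "\<lambda>n. 1 / (real n * fact n)"
  have "((\<lambda>x. \<Sum>n. ?c n * x ^ n) has_field_derivative (\<Sum>n. diffs ?c n * x ^ n)) (at x)"
    by (rule termdiffs_strong_converges_everywhere) (rule summable_Ein)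
  moreover have "(\<lambda>n. diffs ?c n * x ^ n) sums ((exp x - 1) / x)"
  proof -
    have "(\<lambda>n. x ^ Suc n /\<^sub>R fact (Suc n)) sums (exp x - 1)"
      using exp_converges[of x] sums_Suc_iff[of "\<lambda>n. x ^ n /\<^sub>R fact n" "exp x - 1"] by simp
    then have "(\<lambda>n. x ^ Suc n /\<^sub>R fact (Suc n) / x) sums ((exp x - 1) / x)"
      by (rule sums_divide)
    also have "(\<lambda>n. x ^ Suc n /\<^sub>R fact (Suc n) / x) = (\<lambda>n. diffs ?c n * x ^ n)"
      using assms by (simp add: diffs_def field_simps del: fact_Suc of_nat_Suc)
    finally show ?thesis .
  qed
  ultimately show ?thesis unfolding Ein_def[abs_def] by (simp add: sums_iff)
qed

lemma isCont_Ein: "isCont Ein x"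
proof (cases "x = 0")
  case True
  show ?thesis
    unfolding Ein_def by (rule isCont_powser_converges_everywhere) (rule summable_Ein)
qed (use DERIV_Ein DERIV_isCont in blast)

text \<open>Both sides have derivative \<open>- exp (- s) / s\<close>, so they differ by a constant, called \<open>D\<close> in the proof. Its value is found
  as \<open>s\<close> tends to \<open>0\<close>, by comparison with the tail of Gauss' integral for \<open>\<psi>(1) = - \<gamma>\<close>: the two tails
  differ by \<open>ln (1 - exp (- s))\<close>, which cancels the singularity \<open>ln s\<close>.\<close>

lemma exp_integral_tail:
  fixes s :: real assumes s: "s > 0"
  shows "set_integrable lborel {s<..} (\<lambda>t. exp (- t) / t)"
    and "(LINT t:{s<..}|lborel. exp (- t) / t) = - euler_mascheroni - ln s - Ein (- s)"
proof -
  have int: "set_integrable lborel {s<..} (\<lambda>t. exp (- t) / t)" if "s > 0" for s :: real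
  proof (rule set_integrable_bound)
    show "set_integrable lborel {s<..} (\<lambda>t. exp (- t) / s)"
      using exp_neg_integrable_Ioi[of 1 s] by (auto intro!: set_integrable_divide)
  qed (use that in \<open>auto simp: set_borel_measurable_def intro!: AE_I2 divide_left_mono\<close>)
  then show "set_integrable lborel {s<..} (\<lambda>t. exp (- t) / t)" using s .
  define E where "E s = (LINT t:{s<..}|lborel. exp (- t) / t)" for s :: real
  \<comment> \<open>the difference of the two sides of the claim, up to a constant\<close>
  define D where "D s = E s + ln s + Ein (- s)" for s :: real
  have const: "D s = D c" if "0 < s" "s < c" for s c
  proof -
    have "(LINT t:{s<..<c}|lborel. exp (- t) / t) = (ln c + Ein (- c)) - (ln s + Ein (- s))"
    proof (rule FTC_Ioo_nonneg(2)[OF that(2)])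
      show "((\<lambda>t. ln t + Ein (- t)) has_real_derivative exp (- t) / t) (at t)" if "s < t" for t
        using that \<open>0 < s\<close>
        by (auto intro!: derivative_eq_intros DERIV_chain2[OF DERIV_Ein] simp: field_simps)
      show "((\<lambda>t. ln t + Ein (- t)) \<longlongrightarrow> ln s + Ein (- s)) (at_right s)"
        using that by (intro tendsto_intros isCont_tendsto_compose[OF isCont_Ein]) auto
      show "((\<lambda>t. ln t + Ein (- t)) \<longlongrightarrow> ln c + Ein (- c)) (at_left c)"
        using that by (intro tendsto_intros isCont_tendsto_compose[OF isCont_Ein]) auto
    qed (use that in \<open>auto intro!: continuous_intros\<close>)
    moreover have "E s = (LINT t:{s<..<c}|lborel. exp (- t) / t) + E c"
    proof -
      have "E s = (LINT t:{s<..<c} \<union> {c..}|lborel. exp (- t) / t)"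
        using that unfolding E_def by (intro arg_cong2[where f="set_lebesgue_integral lborel"]) auto
      also have "\<dots> = (LINT t:{s<..<c}|lborel. exp (- t) / t) + (LINT t:{c..}|lborel. exp (- t) / t)"
        by (rule set_integral_Un)
          (use that in \<open>auto intro: set_integrable_subset[OF int[OF that(1)]]\<close>)
      finally show ?thesis by (simp add: E_def set_integral_Ici_eq_Ioi)
    qed
    ultimately show ?thesis by (simp add: D_def)
  qed
  let ?h = "\<lambda>t::real. exp (- (1 * t)) * (1 / t - 1 / (1 - exp (- t)))"
  note dig = Digamma_minus_ln_integral[of 1, simplified zero_less_one, OF TrueI]
  have part: "(LINT t:{s<..}|lborel. ?h t) = E s + ln (1 - exp (- s))" if s: "s > 0" for s :: real
  proof -
    have tends: "((\<lambda>t. ln (1 - exp (- t))) \<longlongrightarrow> ln (1 - exp (- s))) (at_right s)"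
      using s by (intro tendsto_intros) auto
    have top: "((\<lambda>t::real. ln (1 - exp (- t))) \<longlongrightarrow> 0) at_top" by real_asymp
    have "set_integrable lborel {s<..} (\<lambda>t. exp (- t) / (1 - exp (- t)))"
       "(LINT t:{s<..}|lborel. exp (- t) / (1 - exp (- t))) = 0 - ln (1 - exp (- s))"
      by (rule FTC_Ioi_nonneg[OF _ _ _ tends top];
          use s in \<open>auto intro!: derivative_eq_intros continuous_intros\<close>)+
    moreover have "(LINT t:{s<..}|lborel. ?h t) =
        (LINT t:{s<..}|lborel. exp (- t) / t - exp (- t) / (1 - exp (- t)))"
      by (simp add: right_diff_distrib)
    ultimately show ?thesis using int[OF s] by (simp add: E_def)
  qed
  have lim0: "((\<lambda>s. LINT t:{s<..}|lborel. ?h t) \<longlongrightarrow> (LINT t:{0<..}|lborel. ?h t)) (at_right 0)"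
  proof (rule tendsto_at_right_sequentially[where b=1])
    fix S :: "nat \<Rightarrow> real" assume S: "\<And>n. 0 < S n" "S \<longlonglongrightarrow> 0"
    show "(\<lambda>n. LINT t:{S n<..}|lborel. ?h t) \<longlonglongrightarrow> (LINT t:{0<..}|lborel. ?h t)"
      unfolding set_lebesgue_integral_def
    proof (rule integral_dominated_convergence)
      show "integrable lborel (\<lambda>t. norm (indicator {0<..} t *\<^sub>R ?h t))"
        using dig(1) unfolding set_integrable_def by (rule integrable_norm)
      show "AE t in lborel. (\<lambda>n. indicator {S n<..} t *\<^sub>R ?h t) \<longlonglongrightarrow> indicator {0<..} t *\<^sub>R ?h t"
      proof (intro AE_I2)
        fix t :: real
        show "(\<lambda>n. indicator {S n<..} t *\<^sub>R ?h t) \<longlonglongrightarrow> indicator {0<..} t *\<^sub>R ?h t"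
        proof (cases "t > 0")
          case True
          have "eventually (\<lambda>n. S n < t) sequentially" using S(2) True by (rule order_tendstoD)
          then have "eventually (\<lambda>n. indicator {0<..} t *\<^sub>R ?h t = indicator {S n<..} t *\<^sub>R ?h t) sequentially"
            by eventually_elim (use True in simp)
          then show ?thesis by (rule Lim_transform_eventually[OF tendsto_const])
        next
          case False
          then have "\<not> S n < t" for n using S(1)[of n] by linarith
          with False show ?thesis by simp
        qed
      qed
      show "AE t in lborel. norm (indicator {S n<..} t *\<^sub>R ?h t) \<le> norm (indicator {0<..} t *\<^sub>R ?h t)" for n
        using S(1)[of n] by (intro AE_I2) (auto split: split_indicator)
    qed measurable
  qed auto
  have "eventually (\<lambda>s. (LINT t:{s<..}|lborel. ?h t) = E s + ln (1 - exp (- s))) (at_right 0)"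
    unfolding eventually_at_right_field using part by (intro exI[of _ 1]) auto
  from Lim_transform_eventually[OF lim0 this]
  have limE: "((\<lambda>s. E s + ln (1 - exp (- s))) \<longlongrightarrow> - euler_mascheroni) (at_right 0)"
    unfolding dig(2) by simp
  have "((\<lambda>s. E s + ln (1 - exp (- s))) \<longlongrightarrow> D 1 + 0 - Ein (- 0)) (at_right 0)"
  proof (rule Lim_transform_eventually)
    have "((\<lambda>s::real. ln (1 - exp (- s)) - ln s) \<longlongrightarrow> 0) (at_right 0)" by real_asymp
    then show "((\<lambda>s. D 1 + (ln (1 - exp (- s)) - ln s) - Ein (- s)) \<longlongrightarrow> D 1 + 0 - Ein (- 0)) (at_right 0)"
      by (intro tendsto_intros isCont_tendsto_compose[OF isCont_Ein]) auto
    show "eventually (\<lambda>s. D 1 + (ln (1 - exp (- s)) - ln s) - Ein (- s) = E s + ln (1 - exp (- s))) (at_right 0)"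
    proof -
      have "D 1 + (ln (1 - exp (- s)) - ln s) - Ein (- s) = E s + ln (1 - exp (- s))"
        if "0 < s" "s < 1" for s
        using const[OF that, unfolded D_def[of s]] by simp
      then show ?thesis unfolding eventually_at_right_field by (intro exI[of _ 1]) auto
    qed
  qed
  from tendsto_unique[OF trivial_limit_at_right_real limE this]
  have "D 1 = - euler_mascheroni" by simp
  moreover have "D s = D 1"
    using const[of s 1] const[of 1 s, symmetric] s by (cases s "1 :: real" rule: linorder_cases) auto
  ultimately show "(LINT t:{s<..}|lborel. exp (- t) / t) = - euler_mascheroni - ln s - Ein (- s)"
    by (simp add: D_def E_def)
qed

text \<open>For \<open>x > 0\<close> the excised integral is computed exactly with the antiderivative \<open>ln \<bar>t\<bar> + Ein (- t)\<close> on
  both sides of the pole. The logarithms at the two cut points cancel, which is why the principal value exists.\<close>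

theorem Ei_eq:
  assumes "x \<noteq> 0"
  shows "Ei x = euler_mascheroni + ln \<bar>x\<bar> + Ein x"
proof (cases "x < 0")
  case True
  then show ?thesis
    using exp_integral_tail(2)[of "- x"] by (simp add: Ei_def set_integral_Ici_eq_Ioi)
next
  case False
  with assms have x: "x > 0" by simp
  let ?P = "\<lambda>e. LINT t:{-x..-e} \<union> {e..}|lborel. exp (- t) / t"
  have P: "?P e = Ein e - Ein (- e) - (euler_mascheroni + ln x + Ein x)" if e: "0 < e" "e < x" for e
  proof -
    have F: "((\<lambda>t. ln (- t) + Ein (- t)) has_real_derivative exp (- t) / t) (at t)" if "t < 0" for t
      using that by (auto intro!: derivative_eq_intros DERIV_chain2[OF DERIV_Ein] simp: field_simps)
    have "has_bochner_integral lborel (\<lambda>t. exp (- t) / t * indicator {-x..-e} t)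
        ((ln (- (- e)) + Ein (- (- e))) - (ln (- (- x)) + Ein (- (- x))))"
      by (rule has_bochner_integral_FTC_Icc_real) (use e F in \<open>auto intro!: continuous_intros\<close>)
    then have I: "set_integrable lborel {-x..-e} (\<lambda>t. exp (- t) / t)"
        "(LINT t:{-x..-e}|lborel. exp (- t) / t) = ln e + Ein e - ln x - Ein x"
      by (auto simp: set_integrable_def set_lebesgue_integral_def has_bochner_integral_iff mult.commute)
    have J: "set_integrable lborel {e..} (\<lambda>t. exp (- t) / t)"
      using e by (intro set_integrable_subset[OF exp_integral_tail(1)[of "e / 2"]]) auto
    have "?P e = (LINT t:{-x..-e}|lborel. exp (- t) / t) + (LINT t:{e..}|lborel. exp (- t) / t)"
      by (rule set_integral_Un) (use e I J in auto)
    then show ?thesis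
      using I(2) exp_integral_tail(2)[OF e(1)] by (simp add: set_integral_Ici_eq_Ioi)
  qed
  have "((\<lambda>e. Ein e - Ein (- e) - (euler_mascheroni + ln x + Ein x)) \<longlongrightarrow>
      Ein 0 - Ein (- 0) - (euler_mascheroni + ln x + Ein x)) (at_right 0)"
    by (intro tendsto_intros isCont_tendsto_compose[OF isCont_Ein])
  moreover have "eventually (\<lambda>e. Ein e - Ein (- e) - (euler_mascheroni + ln x + Ein x) = ?P e) (at_right 0)"
    unfolding eventually_at_right_field using x P[symmetric] by (intro exI[of _ x]) blast
  ultimately have "(?P \<longlongrightarrow> Ein 0 - Ein (- 0) - (euler_mascheroni + ln x + Ein x)) (at_right 0)"
    by (rule Lim_transform_eventually)
  then have "(?P \<longlongrightarrow> - (euler_mascheroni + ln x + Ein x)) (at_right 0)"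
    by simp
  then have "Lim (at_right 0) ?P = - (euler_mascheroni + ln x + Ein x)"
    by (rule tendsto_Lim[OF trivial_limit_at_right_real])
  then show ?thesis using x by (simp add: Ei_def)
qed

lemma DERIV_Ei:
  assumes "x \<noteq> 0"
  shows "(Ei has_real_derivative exp x / x) (at x)"
proof -
  have "((\<lambda>x. euler_mascheroni + ln \<bar>x\<bar> + Ein x) has_real_derivative 0 + 1 / x + (exp x - 1) / x) (at x)"
  proof (intro DERIV_add DERIV_const DERIV_Ein assms)
    show "((\<lambda>x. ln \<bar>x\<bar>) has_real_derivative 1 / x) (at x)"
    proof (cases "x > 0")
      case True
      have "(ln has_real_derivative 1 / x) (at x)" using True by (rule DERIV_ln_divide)
      then show ?thesis
        by (rule has_field_derivative_transform_within[of _ _ _ _ x]) (use True in \<open>auto simp: dist_real_def\<close>)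
    next
      case False
      have "((\<lambda>x. ln (- x)) has_real_derivative 1 / x) (at x)"
        using False assms by (auto intro!: derivative_eq_intros)
      then show ?thesis
        by (rule has_field_derivative_transform_within[of _ _ _ _ "- x"])
           (use False assms in \<open>auto simp: dist_real_def\<close>)
    qed
  qed
  moreover have "0 + 1 / x + (exp x - 1) / x = exp x / x" by (simp add: diff_divide_distrib)
  ultimately have "((\<lambda>x. euler_mascheroni + ln \<bar>x\<bar> + Ein x) has_real_derivative exp x / x) (at x)" by simp
  then show ?thesis
    by (rule has_field_derivative_transform_within[of _ _ _ _ "\<bar>x\<bar>"])
       (use assms in \<open>auto simp: dist_real_def Ei_eq\<close>)
qed

lemma Ei_minus_tendsto_0: "((\<lambda>u. Ei (- u)) \<longlongrightarrow> 0) at_top"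
proof (rule tendsto_0_le)
  show "((\<lambda>u::real. exp (- u)) \<longlongrightarrow> 0) at_top" by real_asymp
  show "eventually (\<lambda>u. norm (Ei (- u)) \<le> norm (exp (- u)) * 1) at_top"
    using eventually_ge_at_top[of 1]
  proof eventually_elim
    case (elim u)
    then have u: "u > 0" by simp
    have Ei: "Ei (- u) = - (LINT t:{u<..}|lborel. exp (- t) / t)"
      using u by (simp add: Ei_def set_integral_Ici_eq_Ioi)
    have "(LINT t:{u<..}|lborel. exp (- t) / t) \<le> (LINT t:{u<..}|lborel. exp (- (1 * t)))"
      by (intro set_integral_mono exp_integral_tail(1) exp_neg_integrable_Ioi)
         (use elim in \<open>auto simp: divide_le_eq\<close>)
    also have "\<dots> = exp (- u)" by (subst exp_neg_integral_Ioi) auto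
    finally have "(LINT t:{u<..}|lborel. exp (- t) / t) \<le> exp (- u)" .
    moreover have "0 \<le> (LINT t:{u<..}|lborel. exp (- t) / t)"
      unfolding set_lebesgue_integral_def
      by (intro Bochner_Integration.integral_nonneg) (use u in \<open>auto split: split_indicator\<close>)
    ultimately show ?case by (simp add: Ei)
  qed
qed

section \<open>Weighted integrals of the kernel and the closed form\<close>

text \<open>The factor \<open>1 / (exp (\<pi> x / 2) + 1)\<close> decays
  exponentially, so integrability of \<open>c\<close> alone justifies
  exchanging its integral with the one in the sine transform of the kernel.\<close>

lemma csch_kernel_weighted_integral:
  fixes c :: "real \<Rightarrow> real"
  assumes c: "integrable lborel c" and c0: "\<And>u. u \<le> 0 \<Longrightarrow> c u = 0"
  shows "(LINT u|lborel. c u * csch_kernel u) =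
    (LINT x:{0<..}|lborel. (LINT u|lborel. c u * sin (u * x)) * (2 / (exp (pi / 2 * x) + 1)))"
proof -
  let ?g = "\<lambda>u x::real. c u * (indicator {0<..} x * (2 * sin (u * x) / (exp (pi / 2 * x) + 1)))"
  have ps: "pair_sigma_finite lborel (lborel :: real measure)" ..
  have [measurable]: "c \<in> borel_measurable borel" using c by auto
  have meas: "case_prod ?g \<in> borel_measurable (lborel \<Otimes>\<^sub>M lborel)" by measurable
  have int1: "integrable lborel (\<lambda>u. \<bar>c u\<bar>)" using c by auto
  have int2: "integrable lborel (\<lambda>x. indicator {0<..} x * (2 * exp (- (pi / 2 * x))))"
    using set_integrable_mult_right[OF exp_neg_integrable_Ioi[of "pi / 2" 0], of 2]
    by (simp add: set_integrable_def)
  have bnd: "norm (?g u x) \<le> \<bar>c u\<bar> * (indicator {0<..} x * (2 * exp (- (pi / 2 * x))))" for u x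
  proof -
    have "\<bar>2 * sin (u * x) / (exp (pi / 2 * x) + 1)\<bar> \<le> 2 / exp (pi / 2 * x)"
      unfolding abs_divide by (rule frac_le) (auto simp: abs_mult)
    then have "\<bar>2 * sin (u * x) / (exp (pi / 2 * x) + 1)\<bar> \<le> 2 * exp (- (pi / 2 * x))"
      by (simp only: exp_minus divide_inverse)
    from mult_left_mono[OF this abs_ge_zero[of "c u"]] show ?thesis
      by (cases "x > 0") (simp_all only: real_norm_def abs_mult indicator_simps greaterThan_iff, simp_all)
  qed
  note fub = Fubini_product_bound(2)[OF ps meas int1 int2 bnd]
  have "(LINT x|lborel. ?g u x) = c u * (LINT x:{0<..}|lborel. 2 * sin (u * x) / (exp (pi / 2 * x) + 1))" for u
    by (simp only: integral_mult_right_zero set_lebesgue_integral_def real_scaleR_def)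
  then have A: "(LINT x|lborel. ?g u x) = c u * csch_kernel u" for u
    using csch_kernel_sine_transform[of u] c0[of u] by (cases "u > 0") auto
  have B: "(LINT u|lborel. ?g u x) =
      indicator {0<..} x *\<^sub>R ((LINT u|lborel. c u * sin (u * x)) * (2 / (exp (pi / 2 * x) + 1)))" for x
  proof -
    have "(LINT u|lborel. ?g u x) =
        (LINT u|lborel. indicator {0<..} x * (2 / (exp (pi / 2 * x) + 1)) * (c u * sin (u * x)))"
      by (rule Bochner_Integration.integral_cong) auto
    also have "\<dots> = indicator {0<..} x * (2 / (exp (pi / 2 * x) + 1)) * (LINT u|lborel. c u * sin (u * x))"
      by (simp only: integral_mult_right_zero)
    finally show ?thesis by (simp only: real_scaleR_def ac_simps)
  qed
  show ?thesis using fub unfolding A B set_lebesgue_integral_def by (rule sym)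
qed

lemma csch_kernel_Laplace:
  assumes w: "w > 0"
  shows "(LINT u:{0<..}|lborel. exp (- (w * u)) * csch_kernel u) =
    (LINT x:{0<..}|lborel. 2 * x / ((w\<^sup>2 + x\<^sup>2) * (exp (pi / 2 * x) + 1)))"
proof -
  let ?c = "\<lambda>u. indicator {0<..} u * exp (- (w * u))"
  have c: "integrable lborel ?c"
    using exp_neg_integrable_Ioi[OF w, of 0] by (simp add: set_integrable_def)
  have sine: "(LINT u|lborel. ?c u * sin (u * x)) = x / (w\<^sup>2 + x\<^sup>2)" for x
  proof -
    have "(LINT u|lborel. ?c u * sin (u * x)) = (LINT u:{0<..}|lborel. exp (- (w * u)) * sin (x * u))"
      by (simp add: set_lebesgue_integral_def ac_simps)
    then show ?thesis by (simp add: sin_exp_integral_Ioi(2)[OF w])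
  qed
  have "(LINT u:{0<..}|lborel. exp (- (w * u)) * csch_kernel u) = (LINT u|lborel. ?c u * csch_kernel u)"
    by (simp add: set_lebesgue_integral_def ac_simps)
  also have "\<dots> = (LINT x:{0<..}|lborel. x / (w\<^sup>2 + x\<^sup>2) * (2 / (exp (pi / 2 * x) + 1)))"
    using csch_kernel_weighted_integral[OF c] by (simp only: sine) simp
  also have "(\<lambda>x. x / (w\<^sup>2 + x\<^sup>2) * (2 / (exp (pi / 2 * x) + 1))) =
      (\<lambda>x. 2 * x / ((w\<^sup>2 + x\<^sup>2) * (exp (pi / 2 * x) + 1)))"
    by (simp add: mult.commute)
  finally show ?thesis .
qed

lemma DERIV_log_tanh:
  assumes u: "u > 0"
  shows "((\<lambda>u. ln ((1 - exp (- u)) / (1 + exp (- u)))) has_real_derivative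
    2 * exp (- u) / (1 - exp (- u) ^ 2)) (at u)"
proof -
  define q where "q = exp (- u)"
  have q: "0 < q" "q < 1" using u by (auto simp: q_def)
  have f: "1 - q ^ 2 = (1 - q) * (1 + q)" by (simp add: power2_eq_square algebra_simps)
  have "((\<lambda>u. 1 - exp (- u)) has_real_derivative q) (at u)" "((\<lambda>u. 1 + exp (- u)) has_real_derivative - q) (at u)"
    by (auto intro!: derivative_eq_intros simp: q_def)
  moreover have "1 + exp (- u) \<noteq> 0" using exp_gt_zero[of "- u"] by linarith
  ultimately have "((\<lambda>u. (1 - exp (- u)) / (1 + exp (- u))) has_real_derivative
      (q * (1 + exp (- u)) - (1 - exp (- u)) * - q) / ((1 + exp (- u)) * (1 + exp (- u)))) (at u)"
    by (rule DERIV_divide)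
  then
  have "((\<lambda>u. (1 - exp (- u)) / (1 + exp (- u))) has_real_derivative
      (q * (1 + q) - (1 - q) * - q) / ((1 + q) * (1 + q))) (at u)"
    by (simp only: q_def)
  moreover have "(1 - exp (- u)) / (1 + exp (- u)) > 0"
    using u by (intro divide_pos_pos add_pos_pos) auto
  ultimately have "((\<lambda>u. ln ((1 - exp (- u)) / (1 + exp (- u)))) has_real_derivative
      1 / ((1 - q) / (1 + q)) * ((q * (1 + q) - (1 - q) * - q) / ((1 + q) * (1 + q)))) (at u)"
    unfolding q_def by (intro DERIV_chain2[OF DERIV_ln_divide])
  moreover have "q * (1 + q) - (1 - q) * - q = 2 * q" by (simp add: algebra_simps)
  moreover have "1 / ((1 - q) / (1 + q)) * (2 * q / ((1 + q) * (1 + q))) = 2 * q / (1 - q ^ 2)"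
    unfolding f using q by simp
  ultimately show ?thesis by (simp only: q_def)
qed

lemma DERIV_arctan_exp_neg:
  "((\<lambda>u. 2 * arctan (exp (- u))) has_real_derivative - 2 * exp (- u) / (1 + exp (- u) ^ 2)) (at u)"
proof -
  have "((\<lambda>u. 2 * arctan (exp (- u))) has_real_derivative 2 * (inverse (1 + exp (- u) ^ 2) * - exp (- u))) (at u)"
    by (intro DERIV_cmult DERIV_chain2[OF DERIV_arctan]) (auto intro!: derivative_eq_intros)
  then show ?thesis by (simp add: divide_inverse ac_simps)
qed

lemma isCont_csch_kernel: "u > 0 \<Longrightarrow> isCont csch_kernel u"
  unfolding csch_kernel_def by (intro continuous_intros) auto

text \<open>In terms of \<open>exp (- u)\<close> the integrals below become integrals of rational functions.\<close>

lemma csch_kernel_exp: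
  assumes "u > 0"
  shows "csch_kernel u = 1 / u - 4 * exp (- u) ^ 2 / (1 - exp (- u) ^ 4)"
proof -
  define p where "p = exp (- (2 * u))"
  have p: "0 < p" "p < 1" using assms by (auto simp: p_def)
  have sq: "exp (- u) ^ 2 = p"
    by (simp add: p_def power2_eq_square flip: exp_add)
  have "exp (- u) ^ 4 = (exp (- u) ^ 2) ^ 2" by (simp only: power_mult[symmetric]) simp
  also have "\<dots> = p * p" unfolding sq by (rule power2_eq_square)
  finally have four: "exp (- u) ^ 4 = p * p" .
  have "exp (2 * u) = 1 / p" by (simp add: p_def exp_minus divide_inverse)
  then have "sinh (2 * u) = (1 / p - p) / 2"
    by (simp only: sinh_field_def p_def)
  moreover have "1 / p - p = (1 - p * p) / p" using p by (simp add: diff_divide_distrib)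
  then have "2 / ((1 / p - p) / 2) = 4 * p / (1 - p * p)" by simp
  ultimately show ?thesis by (simp only: csch_kernel_def sq four)
qed

text \<open>With \<open>q = exp (- u)\<close> the hyperbolic part is
  \<open>4 q\<^sup>3 / (1 - q\<^sup>4) = 2 q / (1 - q\<^sup>2) - 2 q / (1 + q\<^sup>2)\<close>, which integrates to a logarithm and
  an arctangent; \<open>Ei\<close> accounts for \<open>exp (- u) / u\<close>.\<close>

lemma csch_kernel_exp_neg_antiderivative:
  assumes u: "u > 0"
  shows "((\<lambda>u. Ei (- u) - ln ((1 - exp (- u)) / (1 + exp (- u))) - 2 * arctan (exp (- u)))
    has_real_derivative exp (- u) * csch_kernel u) (at u)"
proof -
  define q where "q = exp (- u)"
  have q: "0 < q" "q < 1" using u by (auto simp: q_def)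
  then have q2: "1 - q ^ 2 \<noteq> 0" "1 + q ^ 2 \<noteq> 0"
    using power_less_one_iff[of q 2] by (auto simp: add_pos_nonneg less_imp_neq[THEN not_sym])
  have Ei: "((\<lambda>u. Ei (- u)) has_real_derivative q / u) (at u)"
    using DERIV_Ei[of "- u", unfolded DERIV_mirror] u by (simp add: q_def)
  have f: "1 - q ^ 4 = (1 - q ^ 2) * (1 + q ^ 2)" by (simp add: algebra_simps power_add[symmetric])
  have pf: "2 * q / (1 - q ^ 2) + - 2 * q / (1 + q ^ 2) = 4 * (q * q ^ 2) / ((1 - q ^ 2) * (1 + q ^ 2))"
    unfolding add_frac_eq[OF q2] by (simp add: algebra_simps)
  have "q * (1 / u - 4 * q ^ 2 / D) = q / u - 4 * (q * q ^ 2) / D" for D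
    by (simp add: right_diff_distrib)
  then have "q * csch_kernel u = q / u - (2 * q / (1 - q ^ 2) + - 2 * q / (1 + q ^ 2))"
    unfolding csch_kernel_exp[OF u] q_def[symmetric] f pf .
  then have eq: "q / u - 2 * q / (1 - q ^ 2) - - 2 * q / (1 + q ^ 2) = q * csch_kernel u"
    by simp
  show ?thesis
    using DERIV_diff[OF DERIV_diff[OF Ei DERIV_log_tanh[OF u]] DERIV_arctan_exp_neg[of u]]
    unfolding q_def[symmetric] eq .
qed

lemma csch_kernel_exp_antiderivative:
  assumes u: "u > 0"
  shows "((\<lambda>u. Ei u - ln ((1 - exp (- u)) / (1 + exp (- u))) + 2 * arctan (exp (- u)))
    has_real_derivative exp u * csch_kernel u) (at u)"
proof -
  define q where "q = exp (- u)"
  have q: "0 < q" "q < 1" using u by (auto simp: q_def)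
  then have q2: "1 - q ^ 2 \<noteq> 0" "1 + q ^ 2 \<noteq> 0"
    using power_less_one_iff[of q 2] by (auto simp: add_pos_nonneg less_imp_neq[THEN not_sym])
  have e: "exp u = 1 / q" by (simp add: q_def exp_minus divide_inverse)
  have Ei: "(Ei has_real_derivative (1 / q) / u) (at u)"
    using DERIV_Ei[of u] u by (simp add: e)
  have f: "1 - q ^ 4 = (1 - q ^ 2) * (1 + q ^ 2)" by (simp add: algebra_simps power_add[symmetric])
  have pf: "2 * q / (1 - q ^ 2) + 2 * q / (1 + q ^ 2) = 4 * q / ((1 - q ^ 2) * (1 + q ^ 2))"
    unfolding add_frac_eq[OF q2] by (simp add: algebra_simps)
  have "1 / q * (1 / u - 4 * q ^ 2 / D) = (1 / q) / u - 4 * q / D" for D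
    using q by (simp add: right_diff_distrib power2_eq_square)
  then have "exp u * csch_kernel u = (1 / q) / u - (2 * q / (1 - q ^ 2) + 2 * q / (1 + q ^ 2))"
    unfolding csch_kernel_exp[OF u] e q_def[symmetric] f pf .
  then have eq: "(1 / q) / u - 2 * q / (1 - q ^ 2) + - 2 * q / (1 + q ^ 2) = exp u * csch_kernel u"
    by simp
  show ?thesis
    using DERIV_add[OF DERIV_diff[OF Ei DERIV_log_tanh[OF u]] DERIV_arctan_exp_neg[of u]]
    unfolding q_def[symmetric] eq .
qed

text \<open>The logarithmic singularities of \<open>Ei\<close> and of \<open>ln (tanh (u / 2))\<close> at \<open>0\<close> cancel; what is left is
  \<open>\<gamma>\<close> and, from \<open>tanh (u / 2) \<sim> u / 2\<close>, the constant \<open>ln 2\<close>.\<close>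

lemma Ei_minus_log_tendsto:
  "((\<lambda>u. Ei (- u) - ln ((1 - exp (- u)) / (1 + exp (- u)))) \<longlongrightarrow> euler_mascheroni + ln 2) (at_right 0)"
  "((\<lambda>u. Ei u - ln ((1 - exp (- u)) / (1 + exp (- u)))) \<longlongrightarrow> euler_mascheroni + ln 2) (at_right 0)"
proof -
  have "((\<lambda>u::real. ln u - ln ((1 - exp (- u)) / (1 + exp (- u)))) \<longlongrightarrow> - ln (1 / 2)) (at_right 0)"
    by real_asymp
  then have L: "((\<lambda>u::real. ln u - ln ((1 - exp (- u)) / (1 + exp (- u)))) \<longlongrightarrow> ln 2) (at_right 0)"
    by (simp add: ln_div)
  have "((\<lambda>u. euler_mascheroni + (ln u - ln ((1 - exp (- u)) / (1 + exp (- u)))) + Ein (- u)) \<longlongrightarrow>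
      euler_mascheroni + ln 2 + Ein (- 0)) (at_right 0)"
    by (intro tendsto_add L tendsto_const isCont_tendsto_compose[OF isCont_Ein] tendsto_minus tendsto_ident_at)
  moreover have "eventually (\<lambda>u. euler_mascheroni + (ln u - ln ((1 - exp (- u)) / (1 + exp (- u)))) + Ein (- u) =
      Ei (- u) - ln ((1 - exp (- u)) / (1 + exp (- u)))) (at_right 0)"
    unfolding eventually_at_right_field by (intro exI[of _ 1]) (simp add: Ei_eq)
  ultimately show "((\<lambda>u. Ei (- u) - ln ((1 - exp (- u)) / (1 + exp (- u)))) \<longlongrightarrow> euler_mascheroni + ln 2) (at_right 0)"
    using Lim_transform_eventually by fastforce
  have "((\<lambda>u. euler_mascheroni + (ln u - ln ((1 - exp (- u)) / (1 + exp (- u)))) + Ein u) \<longlongrightarrow>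
      euler_mascheroni + ln 2 + Ein 0) (at_right 0)"
    by (intro tendsto_add L tendsto_const isCont_tendsto_compose[OF isCont_Ein] tendsto_ident_at)
  moreover have "eventually (\<lambda>u. euler_mascheroni + (ln u - ln ((1 - exp (- u)) / (1 + exp (- u)))) + Ein u =
      Ei u - ln ((1 - exp (- u)) / (1 + exp (- u)))) (at_right 0)"
    unfolding eventually_at_right_field by (intro exI[of _ 1]) (simp add: Ei_eq)
  ultimately show "((\<lambda>u. Ei u - ln ((1 - exp (- u)) / (1 + exp (- u)))) \<longlongrightarrow> euler_mascheroni + ln 2) (at_right 0)"
    using Lim_transform_eventually by fastforce
qed

text \<open>Taking the boundary value at \<open>a\<close> as a limit covers both \<open>a > 0\<close> and the singular end point \<open>a = 0\<close>.\<close>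

lemma csch_kernel_tail_integral:
  assumes "a \<ge> 0"
    and lim: "((\<lambda>u. Ei (- u) - ln ((1 - exp (- u)) / (1 + exp (- u))) - 2 * arctan (exp (- u))) \<longlongrightarrow> A) (at_right a)"
  shows "set_integrable lborel {a<..} (\<lambda>u. exp (- u) * csch_kernel u)"
    and "(LINT u:{a<..}|lborel. exp (- u) * csch_kernel u) = - A"
proof -
  have "((\<lambda>u::real. ln ((1 - exp (- u)) / (1 + exp (- u))) + 2 * arctan (exp (- u))) \<longlongrightarrow> 0) at_top"
    by real_asymp
  from tendsto_diff[OF Ei_minus_tendsto_0 this]
  have top: "((\<lambda>u. Ei (- u) - ln ((1 - exp (- u)) / (1 + exp (- u))) - 2 * arctan (exp (- u))) \<longlongrightarrow> 0) at_top"
    by (simp add: algebra_simps)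
  note ftc = FTC_Ioi_nonneg[OF csch_kernel_exp_neg_antiderivative _ _ lim top]
  show "set_integrable lborel {a<..} (\<lambda>u. exp (- u) * csch_kernel u)"
    by (rule ftc(1)) (use assms csch_kernel_nonneg in \<open>auto intro!: continuous_intros isCont_csch_kernel\<close>)
  have "(LINT u:{a<..}|lborel. exp (- u) * csch_kernel u) = 0 - A"
    by (rule ftc(2)) (use assms csch_kernel_nonneg in \<open>auto intro!: continuous_intros isCont_csch_kernel\<close>)
  then show "(LINT u:{a<..}|lborel. exp (- u) * csch_kernel u) = - A" by simp
qed

lemma csch_kernel_total_integral:
  "set_integrable lborel {0<..} (\<lambda>u. exp (- u) * csch_kernel u)"
  "(LINT u:{0<..}|lborel. exp (- u) * csch_kernel u) = pi / 2 - euler_mascheroni - ln 2"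
proof -
  have at: "((\<lambda>u::real. 2 * arctan (exp (- u))) \<longlongrightarrow> 2 * arctan (exp (- 0))) (at_right 0)"
    by (intro tendsto_intros)
  have lim: "((\<lambda>u. Ei (- u) - ln ((1 - exp (- u)) / (1 + exp (- u))) - 2 * arctan (exp (- u))) \<longlongrightarrow>
      euler_mascheroni + ln 2 - 2 * arctan (exp (- 0))) (at_right 0)"
    by (rule tendsto_diff[OF Ei_minus_log_tendsto(1) at])
  show "set_integrable lborel {0<..} (\<lambda>u. exp (- u) * csch_kernel u)"
    by (rule csch_kernel_tail_integral(1)[OF _ lim]) simp
  show "(LINT u:{0<..}|lborel. exp (- u) * csch_kernel u) = pi / 2 - euler_mascheroni - ln 2"
    by (subst csch_kernel_tail_integral(2)[OF _ lim]) (auto simp: arctan_one)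
qed

definition cosine_T :: "real \<Rightarrow> real" where
  "cosine_T s = (LINT x:{0<..}|lborel. cos (s * x) * (2 * x / ((1 + x\<^sup>2) * (exp (pi / 2 * x) + 1))))"

lemma cosine_T_minus: "cosine_T (- s) = cosine_T s"
  by (simp add: cosine_T_def)

lemma cosine_T_0: "cosine_T 0 = pi / 2 - euler_mascheroni - ln 2"
  using csch_kernel_Laplace[of 1] csch_kernel_total_integral(2) by (simp add: cosine_T_def)

text \<open>The weight \<open>c\<close> in the proof is half of \<open>exp (s - u)\<close> for \<open>u > s\<close>, minus \<open>exp (u - s)\<close> for \<open>0 < u < s\<close>, plus
  \<open>exp (- s - u)\<close> for \<open>u > 0\<close>. It is the function with sine transform \<open>x cos (s x) / (1 + x\<^sup>2)\<close>: the
  first two terms give \<open>2 x cos (s x) - x exp (- s)\<close> over \<open>1 + x\<^sup>2\<close>, and the third removes the boundary term at \<open>u = 0\<close>.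
  It remains to integrate the kernel against \<open>c\<close> with the antiderivatives above.\<close>

lemma cosine_T_eq_fourier_T_pos:
  assumes s: "s > 0"
  shows "cosine_T s = fourier_T s"
proof -
  define c where "c u = (exp s * (indicator {s<..} u * exp (- u)) - exp (- s) * (indicator {0<..<s} u * exp u)
      + exp (- s) * (indicator {0<..} u * exp (- u))) / 2" for u
  have i1: "set_integrable lborel {a<..} (\<lambda>u. exp (- u))" for a :: real
    using exp_neg_integrable_Ioi[of 1 a] by simp
  have i2: "set_integrable lborel {0<..<s} (\<lambda>u. exp u)"
  proof (rule set_integrable_subset)
    show "set_integrable lborel {0..s} (\<lambda>u. exp u)"
      by (intro borel_integrable_atLeastAtMost' continuous_intros)
  qed auto
  note i = i1[unfolded set_integrable_def real_scaleR_def] i2[unfolded set_integrable_def real_scaleR_def]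
  have int_c: "integrable lborel c"
    unfolding c_def[abs_def] using i by (intro integrable_divide integrable_add integrable_diff integrable_mult_right) auto
  have sine: "(LINT u|lborel. c u * sin (u * x)) = x * cos (s * x) / (1 + x\<^sup>2)" for x
  proof -
    have x: "1 + x\<^sup>2 \<noteq> 0" by (simp add: add_pos_nonneg less_imp_neq[THEN not_sym])
    have j1: "has_bochner_integral lborel (\<lambda>u. indicator {a<..} u * (exp (- u) * sin (u * x)))
        (exp (- a) * (sin (a * x) + x * cos (a * x)) / (1 + x\<^sup>2))" for a
      using sin_exp_integral_Ioi[of 1 a x]
      by (simp add: set_lebesgue_integral_def set_integrable_def has_bochner_integral_iff mult.commute[of x])
    have "has_bochner_integral lborel (\<lambda>u. exp u * sin (u * x) * indicator {0..s} u)
        (exp s * (sin (s * x) - x * cos (s * x)) / (1 + x\<^sup>2) - exp 0 * (sin (0 * x) - x * cos (0 * x)) / (1 + x\<^sup>2))"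
    proof (rule has_bochner_integral_FTC_Icc_real)
      show "((\<lambda>u. exp u * (sin (u * x) - x * cos (u * x)) / (1 + x\<^sup>2)) has_real_derivative exp u * sin (u * x)) (at u)" for u
        using x by (auto intro!: derivative_eq_intros simp: divide_simps) (simp add: algebra_simps power2_eq_square)
    qed (use s in \<open>auto intro!: continuous_intros\<close>)
    moreover have "has_bochner_integral lborel (\<lambda>u. exp u * sin (u * x) * indicator {0..s} u) v \<longleftrightarrow>
        has_bochner_integral lborel (\<lambda>u. indicator {0<..<s} u * (exp u * sin (u * x))) v" for v
      by (rule has_bochner_integral_discrete_difference[where X="{0, s}"]) (auto split: split_indicator)
    ultimately have j2: "has_bochner_integral lborel (\<lambda>u. indicator {0<..<s} u * (exp u * sin (u * x)))
        ((exp s * (sin (s * x) - x * cos (s * x)) + x) / (1 + x\<^sup>2))"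
      by (simp add: diff_divide_distrib add_divide_distrib)
    have "has_bochner_integral lborel (\<lambda>u. (exp s * (indicator {s<..} u * (exp (- u) * sin (u * x)))
        - exp (- s) * (indicator {0<..<s} u * (exp u * sin (u * x)))
        + exp (- s) * (indicator {0<..} u * (exp (- u) * sin (u * x)))) / 2)
      ((exp s * (exp (- s) * (sin (s * x) + x * cos (s * x)) / (1 + x\<^sup>2))
        - exp (- s) * ((exp s * (sin (s * x) - x * cos (s * x)) + x) / (1 + x\<^sup>2))
        + exp (- s) * (exp (- 0) * (sin (0 * x) + x * cos (0 * x)) / (1 + x\<^sup>2))) / 2)"
      by (intro has_bochner_integral_divide has_bochner_integral_add has_bochner_integral_diff
          has_bochner_integral_mult_right j1 j2)
    then have "(LINT u|lborel. c u * sin (u * x)) =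
      ((exp s * (exp (- s) * (sin (s * x) + x * cos (s * x)) / (1 + x\<^sup>2))
        - exp (- s) * ((exp s * (sin (s * x) - x * cos (s * x)) + x) / (1 + x\<^sup>2))
        + exp (- s) * (exp (- 0) * (sin (0 * x) + x * cos (0 * x)) / (1 + x\<^sup>2))) / 2)"
      by (simp add: has_bochner_integral_iff c_def algebra_simps)
    also have "\<dots> = x * cos (s * x) / (1 + x\<^sup>2)"
    proof -
      have gen: "(E * (F * A / D) - F * ((E * B + x) / D) + F * (x / D)) / 2 = (E * F) * ((A - B) / (2 * D))"
        for A B D E F :: real
        by (simp add: add_divide_distrib diff_divide_distrib algebra_simps)
      have half: "(a + b - (a - b)) / (2 * d) = b / d" for a b d :: real
        by simp
      have zero: "exp (- 0) * (sin (0 * x) + x * cos (0 * x)) = x" by simp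
      show ?thesis unfolding zero gen half exp_minus_inverse by simp
    qed
    finally show ?thesis .
  qed
  let ?L = "\<lambda>u. ln ((1 - exp (- u)) / (1 + exp (- u)))" and ?A = "\<lambda>u::real. 2 * arctan (exp (- u))"
  have cont: "(f \<longlongrightarrow> f s) (at s within S)" if "(f has_real_derivative D) (at s)" for f D S
    using tendsto_within_subset[OF DERIV_isCont[OF that, unfolded isCont_def], of S] by simp
  have lim1: "((\<lambda>u. Ei (- u) - ?L u - ?A u) \<longlongrightarrow> Ei (- s) - ?L s - ?A s) (at_right s)"
    by (rule cont[OF csch_kernel_exp_neg_antiderivative[OF s]])
  have tail: "set_integrable lborel {s<..} (\<lambda>u. exp (- u) * csch_kernel u)"
      "(LINT u:{s<..}|lborel. exp (- u) * csch_kernel u) = - (Ei (- s) - ?L s - ?A s)"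
    using csch_kernel_tail_integral[OF _ lim1] s by auto
  have lim2: "((\<lambda>u. Ei u - ?L u + ?A u) \<longlongrightarrow> Ei s - ?L s + ?A s) (at_left s)"
    by (rule cont[OF csch_kernel_exp_antiderivative[OF s]])
  have "((\<lambda>u. Ei u - ?L u + ?A u) \<longlongrightarrow> euler_mascheroni + ln 2 + 2 * arctan (exp (- 0))) (at_right 0)"
    by (rule tendsto_add[OF Ei_minus_log_tendsto(2)]) (intro tendsto_intros)
  then have lim3: "((\<lambda>u. Ei u - ?L u + ?A u) \<longlongrightarrow> euler_mascheroni + ln 2 + pi / 2) (at_right 0)"
    by (simp add: arctan_one)
  have head: "set_integrable lborel {0<..<s} (\<lambda>u. exp u * csch_kernel u)"
      "(LINT u:{0<..<s}|lborel. exp u * csch_kernel u) =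
        (Ei s - ?L s + ?A s) - (euler_mascheroni + ln 2 + pi / 2)"
    by (rule FTC_Ioo_nonneg[OF s csch_kernel_exp_antiderivative _ _ lim3 lim2];
        use csch_kernel_nonneg in \<open>auto intro!: continuous_intros isCont_csch_kernel\<close>)+
  have "cosine_T s = (LINT x:{0<..}|lborel. (LINT u|lborel. c u * sin (u * x)) * (2 / (exp (pi / 2 * x) + 1)))"
    unfolding cosine_T_def sine by (simp add: ac_simps)
  also have "\<dots> = (LINT u|lborel. c u * csch_kernel u)"
    by (rule csch_kernel_weighted_integral[OF int_c, symmetric]) (use s in \<open>simp add: c_def\<close>)
  also have "\<dots> = (exp s * (LINT u:{s<..}|lborel. exp (- u) * csch_kernel u)
      - exp (- s) * (LINT u:{0<..<s}|lborel. exp u * csch_kernel u)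
      + exp (- s) * (LINT u:{0<..}|lborel. exp (- u) * csch_kernel u)) / 2"
    unfolding c_def set_lebesgue_integral_def real_scaleR_def
  proof (rule has_bochner_integral_integral_eq)
    have "has_bochner_integral lborel (\<lambda>u. (exp s * (indicator {s<..} u * (exp (- u) * csch_kernel u))
        - exp (- s) * (indicator {0<..<s} u * (exp u * csch_kernel u))
        + exp (- s) * (indicator {0<..} u * (exp (- u) * csch_kernel u))) / 2)
      ((exp s * (LINT u|lborel. indicator {s<..} u * (exp (- u) * csch_kernel u))
        - exp (- s) * (LINT u|lborel. indicator {0<..<s} u * (exp u * csch_kernel u))
        + exp (- s) * (LINT u|lborel. indicator {0<..} u * (exp (- u) * csch_kernel u))) / 2)"
      using tail(1) head(1) csch_kernel_total_integral(1)
      unfolding set_integrable_def real_scaleR_def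
      by (intro has_bochner_integral_divide has_bochner_integral_add has_bochner_integral_diff
          has_bochner_integral_mult_right has_bochner_integral_integrable)
    then show "has_bochner_integral lborel (\<lambda>u. (exp s * (indicator {s<..} u * exp (- u))
        - exp (- s) * (indicator {0<..<s} u * exp u)
        + exp (- s) * (indicator {0<..} u * exp (- u))) / 2 * csch_kernel u)
      ((exp s * (LINT u|lborel. indicator {s<..} u * (exp (- u) * csch_kernel u))
        - exp (- s) * (LINT u|lborel. indicator {0<..<s} u * (exp u * csch_kernel u))
        + exp (- s) * (LINT u|lborel. indicator {0<..} u * (exp (- u) * csch_kernel u))) / 2)"
      by (simp add: algebra_simps)
  qed
  also have "\<dots> = (exp s * - (Ei (- s) - ?L s - ?A s)
      - exp (- s) * ((Ei s - ?L s + ?A s) - (euler_mascheroni + ln 2 + pi / 2))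
      + exp (- s) * (pi / 2 - euler_mascheroni - ln 2)) / 2"
    unfolding tail(2) head(2) csch_kernel_total_integral(2) ..
  also have "\<dots> = fourier_T s"
  proof -
    have "(E * - (X - L - 2 * A) - F * ((Y - L + 2 * A) - (g + l + p / 2)) + F * (p / 2 - g - l)) / 2 =
        p / 2 * F + 2 * ((E - F) / 2) * A + (E + F) / 2 * L - (F * Y + E * X) / 2"
      for A E F L X Y g l p :: real
      by (simp add: field_simps)
    then show ?thesis
      using s by (simp only: fourier_T_def sinh_field_def cosh_field_def abs_of_pos)
  qed
  finally show ?thesis .
qed

section \<open>Uniqueness of the characteristics\<close>

text \<open>Lerch's theorem for bounded continuous functions. Put \<open>u = exp (- s)\<close> and \<open>h u = u f (- ln u)\<close>, which
  extends continuously to \<open>{0..1}\<close> because \<open>f\<close> is bounded. The hypothesis says that \<open>h\<close> is orthogonal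
  to every power of \<open>u\<close> and hence to all polynomials, so approximating \<open>h\<close> by polynomials shows that \<open>h\<close> is orthogonal to itself. Starting
  with the exponent \<open>2\<close> leaves one factor \<open>exp (- s)\<close> for \<open>h\<close> and one for the measure \<open>du\<close>.\<close>

lemma Laplace_transform_zero_on_nat:
  fixes f :: "real \<Rightarrow> real"
  assumes cont: "continuous_on UNIV f" and bounded: "\<And>s. \<bar>f s\<bar> \<le> C"
    and zero: "\<And>n::nat. (LINT s:{0<..}|lborel. exp (- (real (n + 2) * s)) * f s) = 0"
    and s: "s \<ge> 0"
  shows "f s = 0"
proof -
  have [measurable]: "f \<in> borel_measurable borel"
    using cont by (rule borel_measurable_continuous_onI)
  have C: "C \<ge> 0" using bounded[of 0] by linarith
  have int: "set_integrable lborel {0<..} (\<lambda>s. exp (- (real (n + 1) * s)) * g s)"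
    if [measurable]: "g \<in> borel_measurable borel" and g: "\<And>s. s > 0 \<Longrightarrow> \<bar>g s\<bar> \<le> B" for g B n
  proof (rule set_integrable_bound)
    show "set_integrable lborel {0<..} (\<lambda>s. exp (- (real (n + 1) * s)) * B)"
      by (intro set_integrable_mult_left exp_neg_integrable_Ioi) simp
    show "AE s in lborel. s \<in> {0<..} \<longrightarrow> norm (exp (- (real (n + 1) * s)) * g s) \<le> norm (exp (- (real (n + 1) * s)) * B)"
    proof (intro AE_I2 impI)
      fix s :: real assume "s \<in> {0<..}"
      then have "\<bar>g s\<bar> \<le> \<bar>B\<bar>" using g[of s] by simp
      then show "norm (exp (- (real (n + 1) * s)) * g s) \<le> norm (exp (- (real (n + 1) * s)) * B)"
        unfolding norm_mult by (intro mult_left_mono) auto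
    qed
  qed (auto simp: set_borel_measurable_def)
  define h where "h u = (if u \<le> 0 then 0 else u * f (- ln u))" for u
  have h_exp: "h (exp (- s)) = exp (- s) * f s" for s by (simp add: h_def)
  have h_cont: "continuous_on {0..1} h"
  proof -
    have "(h \<longlongrightarrow> h u) (at u within {0..1})" if "u \<in> {0..1}" for u
    proof (cases "u = 0")
      case True
      have "(h \<longlongrightarrow> 0) (at 0 within {0..1})"
      proof (rule tendsto_0_le[where K=1])
        show "((\<lambda>u. C * u) \<longlongrightarrow> 0) (at 0 within {0..1})"
          by (intro tendsto_eq_intros) auto
        show "eventually (\<lambda>u. norm (h u) \<le> norm (C * u) * 1) (at 0 within {0..1})"
          unfolding eventually_at
          using bounded C by (intro exI[of _ 1]) (auto simp: h_def abs_mult mult.commute intro!: mult_right_mono)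
      qed
      then show ?thesis using True by (simp add: h_def)
    next
      case False
      with that have u: "u > 0" by simp
      have "((\<lambda>u. u * f (- ln u)) \<longlongrightarrow> u * f (- ln u)) (at u)"
        using u cont by (intro tendsto_intros isCont_tendsto_compose[of _ f])
          (auto simp: continuous_on_eq_continuous_at)
      then have "(h \<longlongrightarrow> u * f (- ln u)) (at u)"
      proof (rule Lim_transform_eventually)
        have "eventually (\<lambda>v. v > 0) (at u)" using u by (rule order_tendstoD(1)[OF tendsto_ident_at])
        then show "eventually (\<lambda>v. v * f (- ln v) = h v) (at u)"
          by eventually_elim (simp add: h_def)
      qed
      then show ?thesis using u by (auto simp: h_def intro: tendsto_within_subset)
    qed
    then show ?thesis by (simp add: continuous_on_def)
  qed
  \<comment> \<open>the square norm of \<open>h\<close> on \<open>{0..1}\<close>, written in the variable \<open>s\<close>\<close>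
  let ?I = "LINT s:{0<..}|lborel. exp (- (3 * s)) * (f s)\<^sup>2"
  have sq: "exp (- (3 * s)) * (f s)\<^sup>2 = exp (- s) * (h (exp (- s)) * h (exp (- s)))" for s
  proof -
    have "exp (- (3 * s)) = exp (- s) * exp (- s) * exp (- s)" by (simp flip: exp_add)
    then show ?thesis by (simp add: h_exp power2_eq_square)
  qed
  have int_sq: "set_integrable lborel {0<..} (\<lambda>s. exp (- (3 * s)) * (f s)\<^sup>2)"
  proof -
    have "\<bar>(f s)\<^sup>2\<bar> \<le> C\<^sup>2" for s using bounded[of s] by (simp add: abs_le_square_iff[symmetric])
    from int[of "\<lambda>s. (f s)\<^sup>2" "C\<^sup>2" 2, OF _ this] show ?thesis by simp
  qed
  have "?I \<le> e * C" if e: "e > 0" for e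
  proof -
    obtain p where p: "real_polynomial_function p" "\<And>x. x \<in> {0..1} \<Longrightarrow> \<bar>h x - p x\<bar> < e"
      using Stone_Weierstrass_real_polynomial_function[OF compact_Icc h_cont e] by blast
    obtain a N where pa: "p = (\<lambda>x. \<Sum>i\<le>N. a i * x ^ i)"
      using p(1) unfolding real_polynomial_function_iff_sum by blast
    have orth_eq: "exp (- s) * (h (exp (- s)) * p (exp (- s))) = (\<Sum>i\<le>N. a i * (exp (- (real (i + 2) * s)) * f s))" for s
    proof -
      have "exp (- s) * (exp (- s) * exp (- s) ^ i) = exp (- (real (i + 2) * s))" for i
        by (simp add: exp_of_nat_mult[symmetric] exp_add[symmetric] algebra_simps)
      then have "exp (- s) * ((exp (- s) * f s) * (a i * exp (- s) ^ i)) = a i * (exp (- (real (i + 2) * s)) * f s)" for i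
        by (metis (no_types, opaque_lifting) mult.assoc mult.commute)
      then show ?thesis unfolding h_exp pa sum_distrib_left by (simp only:)
    qed
    have int_i: "set_integrable lborel {0<..} (\<lambda>s. exp (- (real (i + 2) * s)) * f s)" for i
      using int[of f C "i + 1"] bounded by simp
    have int_p: "set_integrable lborel {0<..} (\<lambda>s. exp (- s) * (h (exp (- s)) * p (exp (- s))))"
      unfolding orth_eq set_integrable_def scaleR_sum_right
      using int_i by (intro Bochner_Integration.integrable_sum) (simp add: set_integrable_def mult.left_commute)
    have orth: "(LINT s:{0<..}|lborel. exp (- s) * (h (exp (- s)) * p (exp (- s)))) = 0"
    proof -
      have "(LINT s:{0<..}|lborel. exp (- s) * (h (exp (- s)) * p (exp (- s)))) =
          (\<Sum>i\<le>N. LINT s:{0<..}|lborel. a i * (exp (- (real (i + 2) * s)) * f s))"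
        unfolding orth_eq set_lebesgue_integral_def scaleR_sum_right
        using int_i by (intro Bochner_Integration.integral_sum) (simp add: set_integrable_def mult.left_commute)
      also have "\<dots> = 0" by (simp only: set_integral_mult_right zero mult_zero_right sum.neutral_const)
      finally show ?thesis .
    qed
    have "?I = (LINT s:{0<..}|lborel. exp (- s) * (h (exp (- s)) * h (exp (- s)))) -
        (LINT s:{0<..}|lborel. exp (- s) * (h (exp (- s)) * p (exp (- s))))"
      unfolding orth sq by simp
    also have "\<dots> = (LINT s:{0<..}|lborel. exp (- s) * (h (exp (- s)) * (h (exp (- s)) - p (exp (- s)))))"
      using int_sq int_p unfolding sq by (subst set_integral_diff(2)[symmetric]) (simp_all add: algebra_simps)
    also have "\<dots> \<le> (LINT s:{0<..}|lborel. exp (- (1 * s)) * (e * C))"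
    proof (rule set_integral_mono)
      show "set_integrable lborel {0<..} (\<lambda>s. exp (- s) * (h (exp (- s)) * (h (exp (- s)) - p (exp (- s)))))"
        using set_integral_diff(1)[OF int_sq[unfolded sq] int_p] by (simp add: algebra_simps)
      show "set_integrable lborel {0<..} (\<lambda>s. exp (- (1 * s)) * (e * C))"
        by (intro set_integrable_mult_left exp_neg_integrable_Ioi) simp
      fix s :: real assume "s \<in> {0<..}"
      then have s: "s > 0" by simp
      have "\<bar>h (exp (- s))\<bar> \<le> 1 * C"
        unfolding h_exp abs_mult using s bounded[of s] by (intro mult_mono) auto
      moreover have "\<bar>h (exp (- s)) - p (exp (- s))\<bar> \<le> e"
        using p(2)[of "exp (- s)"] s by simp
      ultimately have "\<bar>h (exp (- s))\<bar> * \<bar>h (exp (- s)) - p (exp (- s))\<bar> \<le> (1 * C) * e"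
        using C by (intro mult_mono) auto
      then have "h (exp (- s)) * (h (exp (- s)) - p (exp (- s))) \<le> e * C"
        unfolding abs_mult[symmetric] by (simp add: mult.commute)
      then show "exp (- s) * (h (exp (- s)) * (h (exp (- s)) - p (exp (- s)))) \<le> exp (- (1 * s)) * (e * C)"
        by (simp add: mult_left_mono)
    qed
    also have "\<dots> = e * C"
      using exp_neg_integral_Ioi[of 1 0] by (simp only: set_integral_mult_left) simp
    finally show ?thesis .
  qed
  note le = this
  have "?I \<le> 0"
  proof (rule field_le_epsilon)
    fix e :: real assume "e > 0"
    then have "?I \<le> e / (C + 1) * C" using C by (intro le) simp
    also have "\<dots> \<le> 0 + e" using C \<open>e > 0\<close> by (simp add: divide_simps)
    finally show "?I \<le> 0 + e" .
  qed
  moreover have "?I \<ge> 0"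
    unfolding set_lebesgue_integral_def by (intro Bochner_Integration.integral_nonneg) auto
  ultimately have "?I = 0" by simp
  then have "AE s in lborel. indicator {0<..} s *\<^sub>R (exp (- (3 * s)) * (f s)\<^sup>2) = 0"
    using int_sq unfolding set_lebesgue_integral_def set_integrable_def
    by (subst (asm) integral_nonneg_eq_0_iff_AE) auto
  then have ae: "AE s in lborel. s \<notin> {s. 0 < s \<and> f s \<noteq> 0}"
    by eventually_elim (auto split: split_indicator_asm)
  have op: "open {s. 0 < s \<and> f s \<noteq> 0}"
    using cont by (intro open_Collect_conj open_Collect_less open_Collect_neq continuous_intros)
  have pos: "f s = 0" if "s > 0" for s
  proof (rule ccontr)
    assume "f s \<noteq> 0"
    then have "\<not> negligible {s. 0 < s \<and> f s \<noteq> 0}"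
      using that op by (intro open_not_negligible) auto
    then show False using AE_completion[OF ae] op by (simp add: negligible_iff_null_sets AE_iff_null_sets)
  qed
  show ?thesis
  proof (cases "s = 0")
    case True
    have "(f \<longlongrightarrow> f 0) (at_right 0)"
      using cont by (simp add: continuous_on_eq_continuous_at isCont_def filterlim_at_split)
    moreover have "(f \<longlongrightarrow> 0) (at_right 0)"
      by (rule Lim_transform_eventually[OF tendsto_const])
         (auto simp: eventually_at_right_field pos intro!: exI[of _ 1])
    ultimately show ?thesis using True tendsto_unique[OF trivial_limit_at_right_real] by blast
  qed (use pos s in auto)
qed

context finite_borel_measure
begin

lemma iexp_integrable: "integrable M (\<lambda>x. iexp (s * x))"
proof (rule integrable_const_bound[where B=1])
  have [measurable_cong]: "sets M = sets borel" by (rule M_is_borel)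
  show "(\<lambda>x. iexp (s * x)) \<in> borel_measurable M" by measurable
qed simp

lemma isCont_char_finite: "isCont (char M) s"
proof -
  have [measurable_cong]: "sets M = sets borel" by (rule M_is_borel)
  show ?thesis
    unfolding continuous_at_sequentially
  proof safe
    fix X assume X: "X \<longlonglongrightarrow> s"
    show "(char M \<circ> X) \<longlonglongrightarrow> char M s"
      unfolding comp_def char_def
      by (rule integral_dominated_convergence[where w="\<lambda>_. 1"]) (auto intro!: tendsto_intros X)
  qed
qed

lemma norm_char_le: "norm (char M s) \<le> measure M (space M)"
proof -
  have "norm (char M s) \<le> (LINT x|M. norm (iexp (s * x)))"
    unfolding char_def by (rule integral_norm_bound)
  then show ?thesis by simp
qed

lemma char_uminus: "char M (- s) = cnj (char M s)"
proof -
  have "iexp (- s * x) = cnj (iexp (s * x))" for x by (simp add: exp_cnj)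
  then show ?thesis unfolding char_def by (simp only: Bochner_Integration.integral_cnj)
qed

lemma char_0: "char M 0 = measure M (space M)"
  by (simp add: char_def scaleR_conv_of_real)

text \<open>For fixed \<open>x\<close> the resolvent is the Laplace transform of \<open>s \<mapsto> exp (\<i> s x)\<close>; integrate over \<open>x\<close>.\<close>

lemma resolvent_eq_Laplace_char:
  assumes w: "w > 0"
  shows "(CLINT x|M. 1 / (of_real w - \<i> * of_real x)) = (CLINT s:{0<..}|lborel. exp (- (w * s)) *\<^sub>R char M s)"
proof -
  have [measurable_cong]: "sets M = sets borel" by (rule M_is_borel)
  let ?f = "\<lambda>s x. indicator {0<..} s *\<^sub>R exp (- ((of_real w - \<i> * of_real x) * of_real s))"
  have ps: "pair_sigma_finite lborel M" ..
  have meas: "case_prod ?f \<in> borel_measurable (lborel \<Otimes>\<^sub>M M)" by measurable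
  have int1: "integrable lborel (\<lambda>s. indicator {0<..} s * exp (- (w * s)))"
    using exp_neg_integrable_Ioi[OF w, of 0] by (simp add: set_integrable_def)
  have int2: "integrable M (\<lambda>_. 1 :: real)" by simp
  have bnd: "norm (?f s x) \<le> indicator {0<..} s * exp (- (w * s)) * 1" for s x
    by (auto split: split_indicator)
  note fub = Fubini_product_bound(2)[OF ps meas int1 int2 bnd]
  have "(CLINT s|lborel. ?f s x) = 1 / (of_real w - \<i> * of_real x)" for x
    using exp_neg_complex_integral_Ioi(2)[of "of_real w - \<i> * of_real x" 0] w
    by (simp add: set_lebesgue_integral_def)
  moreover have "(CLINT x|M. ?f s x) = indicator {0<..} s *\<^sub>R exp (- (w * s)) *\<^sub>R char M s" for s
  proof -
    have "exp (- ((of_real w - \<i> * of_real x) * of_real s)) = exp (- (w * s)) *\<^sub>R iexp (s * x)" for x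
      by (simp add: scaleR_conv_of_real exp_of_real[symmetric] exp_add[symmetric] algebra_simps)
    then show ?thesis unfolding char_def by simp
  qed
  ultimately show ?thesis using fub by (simp add: set_lebesgue_integral_def)
qed

lemma resolvent_integrable:
  assumes w: "w > 0"
  shows "integrable M (\<lambda>x. 1 / (of_real w - \<i> * of_real x))"
proof (rule integrable_const_bound[where B="1 / w"])
  have "w \<le> norm (of_real w - \<i> * of_real x)" for x
    using abs_Re_le_cmod[of "of_real w - \<i> * of_real x"] w by simp
  moreover have "of_real w - \<i> * of_real x \<noteq> 0" for x using w by (auto simp: complex_eq_iff)
  ultimately show "AE x in M. norm (1 / (of_real w - \<i> * of_real x)) \<le> 1 / w"
    using w by (intro AE_I2) (auto simp: norm_divide intro!: divide_left_mono mult_pos_pos)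
  have [measurable_cong]: "sets M = sets borel" by (rule M_is_borel)
  show "(\<lambda>x. 1 / (of_real w - \<i> * of_real x)) \<in> borel_measurable M" by measurable
qed

text \<open>This isolates the dependence on \<open>x\<close> in the resolvent and shows at which \<open>w\<close> it drops out: only at \<open>w = 1\<close>.\<close>

lemma kernel_eq_resolvent:
  assumes w: "w > 0"
  shows "(\<i> * of_real w * of_real x - 1) / (\<i> * of_real w + of_real x) =
    \<i> * of_real w + \<i> * of_real (1 - w\<^sup>2) * (1 / (of_real w - \<i> * of_real x))"
proof -
  have ne: "of_real w - \<i> * of_real x \<noteq> 0" using w by (auto simp: complex_eq_iff)
  have *: "\<i> * of_real w + of_real x = \<i> * (of_real w - \<i> * of_real x)" by (simp add: algebra_simps)
  show ?thesis unfolding * using ne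
    by (simp add: divide_simps) (simp add: algebra_simps power2_eq_square)
qed

lemma kernel_integrable:
  assumes w: "w > 0"
  shows "integrable M (\<lambda>x. (\<i> * of_real w * of_real x - 1) / (\<i> * of_real w + of_real x))"
  unfolding kernel_eq_resolvent[OF w]
  by (intro Bochner_Integration.integrable_add integrable_mult_right resolvent_integrable[OF w]) simp

lemma kernel_integral:
  assumes w: "w > 0"
  shows "(CLINT x|M. (\<i> * of_real w * of_real x - 1) / (\<i> * of_real w + of_real x)) =
    \<i> * of_real w * of_real (measure M (space M)) +
    \<i> * of_real (1 - w\<^sup>2) * (CLINT x|M. 1 / (of_real w - \<i> * of_real x))"
proof -
  have "(CLINT x|M. (\<i> * of_real w * of_real x - 1) / (\<i> * of_real w + of_real x)) = (CLINT x|M. \<i> * of_real w) +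
      (CLINT x|M. \<i> * of_real (1 - w\<^sup>2) * (1 / (of_real w - \<i> * of_real x)))"
    unfolding kernel_eq_resolvent[OF w]
    by (intro Bochner_Integration.integral_add integrable_mult_right resolvent_integrable[OF w]) simp
  also have "(CLINT x|M. \<i> * of_real w) = \<i> * of_real w * of_real (measure M (space M))"
    by (simp add: scaleR_conv_of_real mult.commute)
  finally show ?thesis by (simp only: integral_mult_right_zero)
qed

end

text \<open>The total mass is the value of the characteristic function at \<open>0\<close>, so both measures can be
  normalised by the same factor, and Levy's theorem for probability measures applies unless they are zero.\<close>

lemma finite_Levy_uniqueness:
  assumes "finite_borel_measure M" "finite_borel_measure N" and char: "char M = char N"
  shows "M = N"
proof -
  interpret M: finite_borel_measure M by fact
  interpret N: finite_borel_measure N by fact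
  have sp: "space M = UNIV" "space N = UNIV"
    using M.M_is_borel N.M_is_borel by (auto dest: sets_eq_imp_space_eq)
  define m where "m = measure M UNIV"
  have m: "measure M UNIV = m" "measure N UNIV = m"
  proof -
    have "complex_of_real (measure M UNIV) = of_real (measure N UNIV)"
      using M.char_0 N.char_0 char unfolding sp by metis
    then show "measure M UNIV = m" "measure N UNIV = m"
      by (simp_all only: m_def of_real_eq_iff)
  qed
  have em: "emeasure M UNIV = ennreal m" "emeasure N UNIV = ennreal m"
    using m by (simp_all add: M.emeasure_eq_measure N.emeasure_eq_measure)
  show ?thesis
  proof (cases "m = 0")
    case True
    show ?thesis
    proof (rule measure_eqI)
      fix A
      have "emeasure M A = 0" "emeasure N A = 0"
        using emeasure_space[of M A] emeasure_space[of N A] em True by (simp_all add: sp)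
      then show "emeasure M A = emeasure N A" by simp
    qed (simp add: M.M_is_borel N.M_is_borel)
  next
    case False
    have "m \<ge> 0" by (simp add: m_def)
    with False have pos: "m > 0" by linarith
    let ?d = "\<lambda>M::real measure. density M (\<lambda>_. ennreal (1 / m))"
    have dist: "real_distribution (?d K)" if "sets K = sets borel" "space K = UNIV" "emeasure K UNIV = ennreal m" for K
    proof -
      have "emeasure (?d K) (space (?d K)) = 1"
        using that pos by (simp add: emeasure_density_const ennreal_mult[symmetric])
      then interpret prob_space "?d K" by (rule prob_spaceI)
      show ?thesis by standard (simp add: that)
    qed
    have chr: "char (?d K) = (\<lambda>s. (1 / m) *\<^sub>R char K s)" if sets: "sets K = sets borel" for K
    proof
      note sets [measurable_cong]
      show "char (?d K) s = (1 / m) *\<^sub>R char K s" for s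
        unfolding char_def using pos by (subst integral_density) auto
    qed
    have "ennreal (1 / m) * ennreal m = 1"
      using pos by (simp flip: ennreal_mult)
    then have recover: "density (?d K) (\<lambda>_. ennreal m) = K" for K :: "real measure"
      by (simp add: density_density_eq density_1)
    have eq: "?d M = ?d N"
    proof (rule Levy_uniqueness)
      show "real_distribution (?d M)" "real_distribution (?d N)"
        using M.M_is_borel N.M_is_borel sp em by (auto intro: dist)
      show "char (?d M) = char (?d N)"
        unfolding chr[OF M.M_is_borel] chr[OF N.M_is_borel] char ..
    qed
    have "M = density (?d M) (\<lambda>_. ennreal m)" by (rule recover[symmetric])
    also have "\<dots> = N" unfolding eq by (rule recover)
    finally show ?thesis .
  qed
qed

text \<open>By \<open>kernel_integral\<close>, \<open>F(i w) = a + i w (b + m) + i (1 - w\<^sup>2) L(w)\<close> with \<open>m\<close> the mass of the measure and \<open>L(w)\<close> the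
  Laplace transform of its characteristic function. The value at \<open>w = 1\<close> yields \<open>a\<close> and \<open>b + m\<close>; then
  \<open>L\<close> is known at \<open>2, 3, \<dots>\<close>, which determines the measure, so \<open>m\<close>, and finally \<open>b\<close>.\<close>

theorem representation_unique:
  assumes "has_representation F a b \<rho>" "has_representation F a' b' \<rho>'"
  shows "a' = a \<and> b' = b \<and> \<rho>' = \<rho>"
proof -
  interpret R: finite_borel_measure \<rho> using assms(1) by (simp add: has_representation_def)
  interpret R': finite_borel_measure \<rho>' using assms(2) by (simp add: has_representation_def)
  define m where "m = measure \<rho> (space \<rho>)"
  define m' where "m' = measure \<rho>' (space \<rho>')"
  let ?L = "\<lambda>\<rho> w. CLINT x|\<rho>. 1 / (of_real w - \<i> * of_real x)"
  have eq: "of_real a + \<i> * of_real (w * (b + m)) + \<i> * of_real (1 - w\<^sup>2) * ?L \<rho> w =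
      of_real a' + \<i> * of_real (w * (b' + m')) + \<i> * of_real (1 - w\<^sup>2) * ?L \<rho>' w" if w: "w > 0" for w
  proof -
    have "F (\<i> * of_real w) = of_real a + \<i> * of_real (w * (b + m)) + \<i> * of_real (1 - w\<^sup>2) * ?L \<rho> w"
      using assms(1) w R.kernel_integral[OF w] by (simp add: has_representation_def m_def algebra_simps)
    moreover have "F (\<i> * of_real w) = of_real a' + \<i> * of_real (w * (b' + m')) + \<i> * of_real (1 - w\<^sup>2) * ?L \<rho>' w"
      using assms(2) w R'.kernel_integral[OF w] by (simp add: has_representation_def m'_def algebra_simps)
    ultimately show ?thesis by simp
  qed
  have ab: "a' = a" "b' + m' = b + m"
    using eq[of 1] by (simp_all add: complex_eq_iff)
  have L: "?L \<rho> w = ?L \<rho>' w" if "w > 1" for w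
  proof -
    have "1 < w\<^sup>2" using that by (simp add: one_less_power)
    then have "1 - w\<^sup>2 \<noteq> 0" by simp
    then have "complex_of_real (1 - w\<^sup>2) \<noteq> 0" by (simp only: of_real_eq_0_iff not_False_eq_True)
    then show ?thesis using eq[of w] that by (simp add: ab)
  qed
  define d where "d s = char \<rho> s - char \<rho>' s" for s
  have cont: "continuous_on UNIV (char \<rho>)" "continuous_on UNIV (char \<rho>')"
    by (intro continuous_at_imp_continuous_on ballI R.isCont_char_finite R'.isCont_char_finite)+
  have d_cont: "continuous_on UNIV d"
    unfolding d_def by (intro continuous_intros cont)
  have d_bound: "norm (d s) \<le> m + m'" for s
    unfolding d_def m_def m'_def
    by (intro order_trans[OF norm_triangle_ineq4] add_mono R.norm_char_le R'.norm_char_le)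
  have int: "set_integrable lborel {0<..} (\<lambda>s. exp (- (w * s)) *\<^sub>R g s)"
    if w: "w > 0" and g: "continuous_on UNIV g" "\<And>s. norm (g s) \<le> B" for w B and g :: "real \<Rightarrow> complex"
  proof (rule set_integrable_bound)
    show "set_integrable lborel {0<..} (\<lambda>s. exp (- (w * s)) * B)"
      by (intro set_integrable_mult_left exp_neg_integrable_Ioi w)
    have [measurable]: "g \<in> borel_measurable borel" using g(1) by (rule borel_measurable_continuous_onI)
    show "set_borel_measurable lborel {0<..} (\<lambda>s. exp (- (w * s)) *\<^sub>R g s)"
      unfolding set_borel_measurable_def by measurable
    show "AE s in lborel. s \<in> {0<..} \<longrightarrow> norm (exp (- (w * s)) *\<^sub>R g s) \<le> norm (exp (- (w * s)) * B)"
      using g(2) by (intro AE_I2) (auto simp: abs_mult intro: order_trans[OF _ abs_ge_self])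
  qed
  have d0: "(CLINT s:{0<..}|lborel. exp (- (real (n + 2) * s)) *\<^sub>R d s) = 0" for n
  proof -
    have w: "real (n + 2) > 0" "real (n + 2) > 1" by auto
    have "(CLINT s:{0<..}|lborel. exp (- (real (n + 2) * s)) *\<^sub>R d s) = ?L \<rho> (real (n + 2)) - ?L \<rho>' (real (n + 2))"
      unfolding R.resolvent_eq_Laplace_char[OF w(1)] R'.resolvent_eq_Laplace_char[OF w(1)]
        d_def scaleR_diff_right
      by (rule set_integral_diff(2)[OF int[OF w(1) cont(1) R.norm_char_le] int[OF w(1) cont(2) R'.norm_char_le]])
    then show ?thesis using L[OF w(2)] by simp
  qed
  have dint: "set_integrable lborel {0<..} (\<lambda>s. exp (- (real (n + 2) * s)) *\<^sub>R d s)" for n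
    by (rule int[OF _ d_cont d_bound]) simp
  have pos: "d s = 0" if s: "s \<ge> 0" for s
  proof -
    have "Re (d s) = 0"
    proof (rule Laplace_transform_zero_on_nat[where C="m + m'", OF _ _ _ s])
      show "continuous_on UNIV (\<lambda>s. Re (d s))" by (intro continuous_intros d_cont)
      show "\<bar>Re (d s)\<bar> \<le> m + m'" for s using abs_Re_le_cmod[of "d s"] d_bound[of s] by linarith
      show "(LINT s:{0<..}|lborel. exp (- (real (n + 2) * s)) * Re (d s)) = 0" for n
        using integral_Re[OF dint[of n, unfolded set_integrable_def]] arg_cong[OF d0[of n], of Re]
        by (simp add: set_lebesgue_integral_def mult.assoc)
    qed
    moreover have "Im (d s) = 0"
    proof (rule Laplace_transform_zero_on_nat[where C="m + m'", OF _ _ _ s])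
      show "continuous_on UNIV (\<lambda>s. Im (d s))" by (intro continuous_intros d_cont)
      show "\<bar>Im (d s)\<bar> \<le> m + m'" for s using abs_Im_le_cmod[of "d s"] d_bound[of s] by linarith
      show "(LINT s:{0<..}|lborel. exp (- (real (n + 2) * s)) * Im (d s)) = 0" for n
        using integral_Im[OF dint[of n, unfolded set_integrable_def]] arg_cong[OF d0[of n], of Im]
        by (simp add: set_lebesgue_integral_def mult.assoc)
    qed
    ultimately show ?thesis by (simp add: complex_eq_iff)
  qed
  have "char \<rho> s = char \<rho>' s" for s
    using pos[of s] pos[of "- s"] by (cases "s \<ge> 0") (auto simp: d_def R.char_uminus R'.char_uminus)
  then have char: "char \<rho> = char \<rho>'" by (rule ext)
  have "finite_borel_measure \<rho>" "finite_borel_measure \<rho>'"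
    using assms by (simp_all add: has_representation_def)
  then have "\<rho> = \<rho>'" using char by (rule finite_Levy_uniqueness)
  then show ?thesis using ab by (simp add: m_def m'_def)
qed

section \<open>The representing measure\<close>

lemma lborel_integral_fold:
  fixes f :: "real \<Rightarrow> 'a :: {banach, second_countable_topology}"
  assumes f: "integrable lborel f"
  shows "(LINT x|lborel. f x) = (LINT x:{0<..}|lborel. f x + f (- x))"
proof -
  have f': "integrable lborel (\<lambda>x. f (- x))"
    using lborel_integrable_real_affine[OF f, of "-1" 0] by simp
  have int: "set_integrable lborel A g" if "integrable lborel g" "A \<in> sets borel" for A and g :: "real \<Rightarrow> 'a"
    unfolding set_integrable_def using that by (intro integrable_mult_indicator) auto
  have "(LINT x|lborel. f x) = (LINT x:{0<..} \<union> {..<0}|lborel. f x)"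
    unfolding set_lebesgue_integral_def
    by (rule integral_discrete_difference[where X="{0}"]) (auto split: split_indicator)
  also have "\<dots> = (LINT x:{0<..}|lborel. f x) + (LINT x:{..<0}|lborel. f x)"
    by (rule set_integral_Un) (auto intro: int f)
  also have "(LINT x:{..<0}|lborel. f x) = \<bar>- 1\<bar> *\<^sub>R (LINT x|lborel. indicator {..<0} (0 + - 1 * x) *\<^sub>R f (0 + - 1 * x))"
    unfolding set_lebesgue_integral_def by (rule lborel_integral_real_affine) simp
  also have "\<dots> = (LINT x:{0<..}|lborel. f (- x))"
    unfolding set_lebesgue_integral_def
    by (simp, rule Bochner_Integration.integral_cong) (auto split: split_indicator)
  also have "(LINT x:{0<..}|lborel. f x) + (LINT x:{0<..}|lborel. f (- x)) = (LINT x:{0<..}|lborel. f x + f (- x))"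
    by (rule set_integral_add(2)[symmetric]) (auto intro: int f f')
  finally show ?thesis .
qed

definition density_T :: "real \<Rightarrow> real" where
  "density_T x = \<bar>x\<bar> / ((1 + x\<^sup>2) * (exp (pi / 2 * \<bar>x\<bar>) + 1))"

definition rho_T :: "real measure" where
  "rho_T = density lborel (\<lambda>x. ennreal (density_T x))"

lemma density_T_measurable [measurable]: "density_T \<in> borel_measurable borel"
  unfolding density_T_def by measurable

lemma density_T_nonneg: "0 \<le> density_T x"
  by (simp add: density_T_def add_nonneg_nonneg)

lemma density_T_minus: "density_T (- x) = density_T x"
  by (simp add: density_T_def)

lemma density_T_pos: "2 * (density_T x * (1 + x\<^sup>2)) = 2 * x / (exp (pi / 2 * x) + 1)" if "x > 0"
proof -
  have "1 + x\<^sup>2 > 0" by (simp add: add_pos_nonneg)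
  then show ?thesis using that by (simp add: density_T_def)
qed

lemma density_T_le: "density_T x \<le> exp (- (pi / 2 * \<bar>x\<bar>))"
proof -
  have "\<bar>x\<bar> \<le> 1 + x\<^sup>2"
    using zero_le_power2[of "\<bar>x\<bar> - 1"] by (simp add: power2_diff)
  then have "\<bar>x\<bar> / (1 + x\<^sup>2) \<le> 1" by (simp add: divide_le_eq_1 add_pos_nonneg)
  moreover have "1 / (exp (pi / 2 * \<bar>x\<bar>) + 1) \<le> exp (- (pi / 2 * \<bar>x\<bar>))"
    unfolding exp_minus inverse_eq_divide by (rule frac_le) auto
  moreover have "(0 :: real) \<le> 1" by simp
  moreover have "0 \<le> 1 / (exp (pi / 2 * \<bar>x\<bar>) + 1)"
    by (intro divide_nonneg_nonneg add_nonneg_nonneg) auto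
  ultimately have "\<bar>x\<bar> / (1 + x\<^sup>2) * (1 / (exp (pi / 2 * \<bar>x\<bar>) + 1)) \<le> 1 * exp (- (pi / 2 * \<bar>x\<bar>))"
    by (rule mult_mono)
  then show ?thesis by (simp only: density_T_def times_divide_times_eq mult_1_right mult_1_left)
qed

lemma density_T_integrable: "integrable lborel density_T"
proof -
  define g where "g x = indicator {0<..} x * exp (- (pi / 2 * x))" for x :: real
  have g: "integrable lborel g"
    using exp_neg_integrable_Ioi[of "pi / 2" 0] by (simp add: g_def[abs_def] set_integrable_def)
  have "integrable lborel (\<lambda>x. g (- x))"
    using lborel_integrable_real_affine[OF g, of "-1" 0] by simp
  with g have "integrable lborel (\<lambda>x. g x + g (- x))" by (rule Bochner_Integration.integrable_add)
  then show ?thesis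
  proof (rule Bochner_Integration.integrable_bound)
    have "density_T x \<le> g x + g (- x)" for x
      using density_T_le[of x] by (cases x "0 :: real" rule: linorder_cases) (auto simp: g_def density_T_def)
    then show "AE x in lborel. norm (density_T x) \<le> norm (g x + g (- x))"
      using density_T_nonneg by (intro AE_I2) (auto intro: order_trans[OF _ abs_ge_self])
  qed simp
qed

interpretation rho_T: finite_borel_measure rho_T
proof (intro finite_borel_measure.intro finite_measureI finite_borel_measure_axioms.intro)
  have "emeasure rho_T (space rho_T) = (\<integral>\<^sup>+x. ennreal (density_T x) \<partial>lborel)"
    by (simp add: rho_T_def emeasure_density)
  also have "\<dots> = ennreal (LINT x|lborel. density_T x)"
    by (rule nn_integral_eq_integral[OF density_T_integrable]) (simp add: density_T_nonneg)
  finally show "emeasure rho_T (space rho_T) \<noteq> \<infinity>" by simp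
qed (simp add: rho_T_def)

text \<open>Folding at \<open>0\<close> reduces integrals against the even density to the half-line and removes the odd part
  of the integrand.\<close>

lemma integral_rho_T:
  fixes f :: "real \<Rightarrow> complex"
  assumes f: "integrable rho_T f"
  shows "(CLINT x|rho_T. f x) = (CLINT x:{0<..}|lborel. density_T x *\<^sub>R (f x + f (- x)))"
proof -
  have [measurable]: "f \<in> borel_measurable borel"
    using borel_measurable_integrable[OF f] by (simp add: rho_T_def)
  have "integrable lborel (\<lambda>x. density_T x *\<^sub>R f x)"
    using f unfolding rho_T_def by (subst (asm) integrable_density) (auto simp: density_T_nonneg)
  from lborel_integral_fold[OF this]
  have "(CLINT x|lborel. density_T x *\<^sub>R f x) = (CLINT x:{0<..}|lborel. density_T x *\<^sub>R (f x + f (- x)))"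
    by (simp add: density_T_minus scaleR_add_right)
  then show ?thesis
    unfolding rho_T_def by (subst integral_density) (auto simp: density_T_nonneg)
qed

lemma char_rho_T: "char rho_T s = of_real (cosine_T s)"
proof -
  have eq: "density_T x *\<^sub>R (iexp (s * x) + iexp (s * - x)) =
      of_real (cos (s * x) * (2 * x / ((1 + x\<^sup>2) * (exp (pi / 2 * x) + 1))))" if "x > 0" for x
  proof -
    have sum: "iexp (s * x) + iexp (s * - x) = of_real (2 * cos (s * x))"
      by (simp add: complex_eq_iff Re_exp Im_exp)
    have dens: "density_T x * (2 * cos (s * x)) = cos (s * x) * (2 * x / ((1 + x\<^sup>2) * (exp (pi / 2 * x) + 1)))"
      using that by (simp add: density_T_def)
    show ?thesis unfolding sum scaleR_conv_of_real of_real_mult[symmetric] dens ..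
  qed
  have "char rho_T s = (CLINT x:{0<..}|lborel. density_T x *\<^sub>R (iexp (s * x) + iexp (s * - x)))"
    unfolding char_def by (rule integral_rho_T[OF rho_T.iexp_integrable])
  also have "\<dots> = (CLINT x:{0<..}|lborel. of_real (cos (s * x) * (2 * x / ((1 + x\<^sup>2) * (exp (pi / 2 * x) + 1)))))"
    by (rule set_lebesgue_integral_cong) (use eq in auto)
  finally show ?thesis by (simp only: set_integral_complex_of_real cosine_T_def)
qed

text \<open>Folding the kernel gives \<open>2 i w (1 + x\<^sup>2) / (w\<^sup>2 + x\<^sup>2)\<close>, and the factor \<open>1 + x\<^sup>2\<close> cancels the one in the
  density.\<close>

lemma rho_T_represents_F_T: "has_representation F_T 0 0 rho_T"
  unfolding has_representation_def
proof (intro conjI allI impI)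
  show "finite_borel_measure rho_T" ..
  fix w :: real assume w: "w > 0"
  let ?K = "\<lambda>x. (\<i> * of_real w * of_real x - 1) / (\<i> * of_real w + of_real x)"
  have sum: "density_T x *\<^sub>R (?K x + ?K (- x)) =
      \<i> * of_real w * of_real (2 * x / ((w\<^sup>2 + x\<^sup>2) * (exp (pi / 2 * x) + 1)))" if x: "x > 0" for x
  proof -
    have ne: "\<i> * of_real w + of_real x \<noteq> 0" "\<i> * of_real w + of_real (- x) \<noteq> 0"
      using w by (auto simp: complex_eq_iff)
    have "?K x + ?K (- x) = \<i> * of_real w * of_real (2 * (1 + x\<^sup>2)) / of_real (w\<^sup>2 + x\<^sup>2)"
    proof -
      have p: "complex_of_real (w\<^sup>2 + x\<^sup>2) =
          - ((\<i> * of_real w + of_real x) * (\<i> * of_real w + of_real (- x)))"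
        by (simp add: algebra_simps power2_eq_square)
      have "?K x + ?K (- x) = ((\<i> * of_real w * of_real x - 1) * (\<i> * of_real w + of_real (- x)) +
          (\<i> * of_real w * of_real (- x) - 1) * (\<i> * of_real w + of_real x)) /
          ((\<i> * of_real w + of_real x) * (\<i> * of_real w + of_real (- x)))"
        by (rule add_frac_eq[OF ne])
      also have "(\<i> * of_real w * of_real x - 1) * (\<i> * of_real w + of_real (- x)) +
          (\<i> * of_real w * of_real (- x) - 1) * (\<i> * of_real w + of_real x) =
          - (\<i> * of_real w * of_real (2 * (1 + x\<^sup>2)))"
        by (simp add: algebra_simps power2_eq_square)
      finally show ?thesis unfolding p by (simp only: divide_minus_left divide_minus_right)
    qed
    then have "density_T x *\<^sub>R (?K x + ?K (- x)) =
        \<i> * of_real w * of_real (2 * (density_T x * (1 + x\<^sup>2)) / (w\<^sup>2 + x\<^sup>2))"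
      by (simp add: scaleR_conv_of_real)
    also have "2 * (density_T x * (1 + x\<^sup>2)) / (w\<^sup>2 + x\<^sup>2) = 2 * x / ((w\<^sup>2 + x\<^sup>2) * (exp (pi / 2 * x) + 1))"
      unfolding density_T_pos[OF x] by (simp add: mult.commute)
    finally show ?thesis .
  qed
  have "(CLINT x|rho_T. ?K x) = (CLINT x:{0<..}|lborel. density_T x *\<^sub>R (?K x + ?K (- x)))"
    by (rule integral_rho_T[OF rho_T.kernel_integrable[OF w]])
  also have "\<dots> = (CLINT x:{0<..}|lborel. \<i> * of_real w * of_real (2 * x / ((w\<^sup>2 + x\<^sup>2) * (exp (pi / 2 * x) + 1))))"
    by (rule set_lebesgue_integral_cong) (use sum in auto)
  also have "\<dots> = \<i> * of_real w * of_real (LINT x:{0<..}|lborel. 2 * x / ((w\<^sup>2 + x\<^sup>2) * (exp (pi / 2 * x) + 1)))"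
    by (simp only: set_integral_mult_right set_integral_complex_of_real)
  also have "\<dots> = \<i> * of_real w * (Digamma (of_real (w / 2)) + beta_fun (of_real (w / 2)) - of_real (ln (w / 2)))"
    unfolding csch_kernel_Laplace[OF w, symmetric] Digamma_beta_Laplace[OF w] ..
  also have "\<dots> = - (- F_T (\<i> * of_real w))"
    unfolding F_T_axis[OF w] by (simp add: algebra_simps)
  finally show "F_T (\<i> * of_real w) = of_real 0 + \<i> * of_real 0 * of_real w + (CLINT x|rho_T. ?K x)"
    by simp
qed simp

lemma cosine_T_eq_fourier_T:
  assumes "s \<noteq> 0"
  shows "cosine_T s = fourier_T s"
proof (cases "s > 0")
  case False
  then have "cosine_T (- s) = fourier_T (- s)"
    using assms by (intro cosine_T_eq_fourier_T_pos) simp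
  moreover have "fourier_T (- s) = fourier_T s" by (simp add: fourier_T_def)
  ultimately show ?thesis by (simp add: cosine_T_minus)
qed (rule cosine_T_eq_fourier_T_pos)

theorem corollary2:
  shows
    "(\<forall>w::real. w > 0 \<longrightarrow>
        V_T (\<i> * of_real w) = - F_T (\<i> * of_real w) \<and>
        - F_T (\<i> * of_real w) = F_S (\<i> * of_real w) - F_C (\<i> * of_real w) \<and>
        F_S (\<i> * of_real w) - F_C (\<i> * of_real w) =
          \<i> * of_real w *
            (of_real (ln (w / 2)) - beta_fun (of_real (w / 2)) - Digamma (of_real (w / 2)))) \<and>
     (\<exists>\<rho>. characteristics F_T 0 0 \<rho> \<and>
        measure \<rho> UNIV = pi / 2 - euler_mascheroni - ln 2 \<and>
        (\<forall>s. s \<noteq> 0 \<longrightarrow> char \<rho> s = of_real (fourier_T s)) \<and>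
        ((\<lambda>s. of_real (fourier_T s)) \<longlongrightarrow> char \<rho> 0) (at 0) \<and>
        (\<forall>s. char \<rho> s =
           of_real (LINT x:{0..}|lborel.
             cos (s * x) * (2 * x / ((1 + x\<^sup>2) * (exp (pi / 2 * x) + 1))))))"
proof (intro conjI allI impI exI[of _ rho_T])
  fix w :: real assume w: "w > 0"
  show "V_T (\<i> * of_real w) = - F_T (\<i> * of_real w)" by (simp add: V_T_def)
  have FC: "F_C (\<i> * of_real w) = - (\<i> * (1 - of_real w * beta_fun (of_real (w / 2))))"
    using F_C_axis[OF w] by (metis minus_minus)
  have FS: "F_S (\<i> * of_real w) =
      - (\<i> * (of_real w * Digamma (of_real (w / 2)) - of_real w * of_real (ln (w / 2)) + 1))"
    using F_S_axis[OF w] by (metis minus_minus)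
  show SC: "F_S (\<i> * of_real w) - F_C (\<i> * of_real w) =
      \<i> * of_real w * (of_real (ln (w / 2)) - beta_fun (of_real (w / 2)) - Digamma (of_real (w / 2)))"
    unfolding FC FS by (simp add: algebra_simps)
  show "- F_T (\<i> * of_real w) = F_S (\<i> * of_real w) - F_C (\<i> * of_real w)"
    unfolding SC by (rule F_T_axis[OF w])
next
  show "characteristics F_T 0 0 rho_T"
    unfolding characteristics_def
    using rho_T_represents_F_T representation_unique[OF rho_T_represents_F_T] by blast
  have "space rho_T = UNIV" by (simp add: rho_T_def)
  then show "measure rho_T UNIV = pi / 2 - euler_mascheroni - ln 2"
    using rho_T.char_0 char_rho_T[of 0] by (simp add: cosine_T_0 del: of_real_diff)
  show char: "char rho_T s = of_real (fourier_T s)" if "s \<noteq> 0" for s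
    by (simp add: char_rho_T cosine_T_eq_fourier_T[OF that])
  have "(char rho_T \<longlongrightarrow> char rho_T 0) (at 0)"
    using rho_T.isCont_char_finite by (simp add: isCont_def)
  then show "((\<lambda>s. of_real (fourier_T s)) \<longlongrightarrow> char rho_T 0) (at 0)"
    by (rule Lim_transform_eventually) (simp add: eventually_at_filter char)
  show "char rho_T s = of_real (LINT x:{0..}|lborel.
      cos (s * x) * (2 * x / ((1 + x\<^sup>2) * (exp (pi / 2 * x) + 1))))" for s
    by (simp only: char_rho_T cosine_T_def set_integral_Ici_eq_Ioi)
qed

end
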